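(* There is an absolute constant $C>0$ such that the following holds for every analytic function $f\colon \mathbb{D}\to\mathbb{C}$. The function $f$ belongs to the Bergman space $\mathcal{A}^2(\mathbb{D})$ (i.e. $\|f\|_{L^2(\mathbb{D})}<+\infty$) if and only if $$\|f\|_{L^1+H^{-1/2}(S^1)}:=\limsup_{r\to 1^-}\|f(re^{i\theta})\|_{L^1+H^{-1/2}(S^1)}<+\infty .$$ Moreover, $$\|f\|_{L^2(\mathbb{D})}\le C\,\|f\|_{L^1+H^{-1/2}(S^1)} .$$
   Context: $\mathbb{D}$ is the open unit disc in $\mathbb{C}$ and $S^1=\mathbb{R}/2\pi\mathbb{Z}$ is the unit circle. $\mathcal{A}^2(\mathbb{D})$ is the space of holomorphic $f\colon\mathbb{D}\to\mathbb{C}$ with $\|f\|_{L^2(\mathbb{D})}<+\infty$ (Lebesgue measure on $\mathbb{D}$). For a distribution $v\in\mathcal{D}'(S^1)$, $\hat v(k)=\frac{1}{2\pi}\langle v,e^{-ik\cdot}\rangle$, and $H^{-1/2}(S^1)$ is the space of $v\in\mathcal{D}'(S^1)$ with $\|v\|_{H^{-1/2}}^2:=\sum_{k\in\mathbb{Z}}(1+|k|^2)^{-1/2}|\hat v(k)|^2<\infty$. $L^1+H^{-1/2}(S^1)$ is the space of distributions $v$ on $S^1$ that can be written $v=g+h$ with $g\in L^1(S^1)$, $h\in H^{-1/2}(S^1)$, with norm $\|v\|_{L^1+H^{-1/2}(S^1)}=\inf\{\|g\|_{L^1}+\|h\|_{H^{-1/2}}: v=g+h\}$. For $0<r<1$,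 $f(re^{i\theta})$ is regarded as a (smooth) function of $\theta\in S^1$. *)

theory Defs
  imports "HOL-Analysis.Analysis"
begin

text \<open>
  Functions on the circle \<open>\<real>/2\<pi>\<int>\<close> are represented as \<open>2\<pi>\<close>-periodic functions on \<open>\<real>\<close>.
  All norms take values in \<^typ>\<open>ennreal\<close>, with value \<open>\<infinity>\<close> where the quantity is not finite.
\<close>

definition ennreal_sqrt :: "ennreal \<Rightarrow> ennreal" where
  "ennreal_sqrt x = (if x = \<infinity> then \<infinity> else ennreal (sqrt (enn2real x)))"

definition periodic_2pi :: "(real \<Rightarrow> complex) \<Rightarrow> bool" where
  "periodic_2pi \<phi> \<longleftrightarrow> (\<forall>x. \<phi> (x + 2 * pi) = \<phi> x)"

definition nth_derivative :: "nat \<Rightarrow> (real \<Rightarrow> complex) \<Rightarrow> real \<Rightarrow> complex" where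
  "nth_derivative n = (\<lambda>\<psi> x. vector_derivative \<psi> (at x)) ^^ n"

definition circle_test_functions :: "(real \<Rightarrow> complex) set" where
  "circle_test_functions =
     {\<phi>. periodic_2pi \<phi> \<and> (\<forall>n x. nth_derivative n \<phi> differentiable (at x))}"

text \<open>
  Complex-linear functionals on the test functions that are continuous for the Frechet topology
  given by the seminorms \<open>\<phi> \<mapsto> (\<Sum>j\<le>N. sup |\<phi>\<^sup>(\<^sup>j\<^sup>)|)\<close>. Only the values on test functions are
  meaningful, so two distributions are identified when they agree on \<^const>\<open>circle_test_functions\<close>.
\<close>

definition circle_distribution :: "((real \<Rightarrow> complex) \<Rightarrow> complex) \<Rightarrow> bool" where
  "circle_distribution v \<longleftrightarrow>
     (\<forall>\<phi>\<in>circle_test_functions. \<forall>\<psi>\<in>circle_test_functions.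
        v (\<lambda>x. \<phi> x + \<psi> x) = v \<phi> + v \<psi>) \<and>
     (\<forall>c. \<forall>\<phi>\<in>circle_test_functions. v (\<lambda>x. c * \<phi> x) = c * v \<phi>) \<and>
     (\<exists>B N. \<forall>\<phi>\<in>circle_test_functions.
        cmod (v \<phi>) \<le> B * (\<Sum>j\<le>N. SUP x. cmod (nth_derivative j \<phi> x)))"

definition fourier_coeff :: "((real \<Rightarrow> complex) \<Rightarrow> complex) \<Rightarrow> int \<Rightarrow> complex" where
  "fourier_coeff v k = v (\<lambda>\<theta>. exp (- \<i> * of_int k * of_real \<theta>)) / of_real (2 * pi)"

definition H_minus_half_norm :: "((real \<Rightarrow> complex) \<Rightarrow> complex) \<Rightarrow> ennreal" where
  "H_minus_half_norm v =
     ennreal_sqrt (\<Sum>\<^sub>\<infinity>k::int. ennreal ((1 + (real_of_int \<bar>k\<bar>)\<^sup>2) powr (-1/2) *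
                                       (cmod (fourier_coeff v k))\<^sup>2))"

definition H_minus_half :: "((real \<Rightarrow> complex) \<Rightarrow> complex) set" where
  "H_minus_half = {v. circle_distribution v \<and> H_minus_half_norm v < \<infinity>}"

definition L1_circle :: "(real \<Rightarrow> complex) set" where
  "L1_circle = {g. periodic_2pi g \<and> g absolutely_integrable_on {0..2*pi}}"

definition L1_circle_norm :: "(real \<Rightarrow> complex) \<Rightarrow> ennreal" where
  "L1_circle_norm g = (\<integral>\<^sup>+\<theta>\<in>{0..2*pi}. ennreal (cmod (g \<theta>)) \<partial>lebesgue)"

definition distribution_of :: "(real \<Rightarrow> complex) \<Rightarrow> (real \<Rightarrow> complex) \<Rightarrow> complex" where
  "distribution_of g = (\<lambda>\<phi>. LINT \<theta>:{0..2*pi}|lebesgue. g \<theta> * \<phi> \<theta>)"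

text \<open>The infimum over an empty set of decompositions is \<open>\<infinity>\<close>.\<close>

definition L1_plus_H_minus_half_norm :: "((real \<Rightarrow> complex) \<Rightarrow> complex) \<Rightarrow> ennreal" where
  "L1_plus_H_minus_half_norm v =
     (INF (g, h) \<in> {(g, h). g \<in> L1_circle \<and> h \<in> H_minus_half \<and>
                        (\<forall>\<phi>\<in>circle_test_functions. v \<phi> = distribution_of g \<phi> + h \<phi>)}.
        L1_circle_norm g + H_minus_half_norm h)"

definition L2_disc_norm :: "(complex \<Rightarrow> complex) \<Rightarrow> ennreal" where
  "L2_disc_norm f = ennreal_sqrt (\<integral>\<^sup>+z\<in>ball 0 1. ennreal ((cmod (f z))\<^sup>2) \<partial>lebesgue)"

definition bergman_space :: "(complex \<Rightarrow> complex) set" where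
  "bergman_space = {f. f holomorphic_on ball 0 1 \<and> L2_disc_norm f < \<infinity>}"

definition boundary_norm :: "(complex \<Rightarrow> complex) \<Rightarrow> ennreal" where
  "boundary_norm f =
     Limsup (at_left 1)
       (\<lambda>r::real. L1_plus_H_minus_half_norm (distribution_of (\<lambda>\<theta>. f (of_real r * cis \<theta>))))"

end

(* Let g be integrable on the circle with Fourier coefficients c(k). The form
   sum over k >= 1 of (|c(k)|^2 - |c(-k)|^2) / k is <g * K, g> for the sawtooth kernel
   K(t) = sum of sgn(k) e^(ikt) / |k|, which is bounded; hence it is at most a constant times the
   square of the L^1 norm of g. If f(r e^(it)) = g + h, then the negative coefficients of g are those
   of -h, so they are controlled by the H^(-1/2) norm of h; by the bound just stated the positive
   ones are controlled as well. With a(n) the Taylor coefficients of f, this bounds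
   sum of |a(n)|^2 r^(2n) / (n + 1) uniformly in r, and pi times this sum at r = 1 is the squared
   Bergman norm. The last identity follows from Parseval on circles, by averaging over rotations
   and integrating |z|^(2n). Conversely, for f in the Bergman space, g = 0 already works. *)

theory Submission
  imports Defs "HOL-Complex_Analysis.Complex_Analysis"
begin

text \<open>The sum of the two halves of the form would have the kernel -2 log |1 - e^(it)|, which
  is unbounded: an integrable function need not lie in H^(-1/2). Their difference keeps only the
  argument of 1 - e^(it), and an angle is bounded. This is why the estimate has to pass through the
  negative frequencies, and it is there that analyticity is used: a power series has none, so g and
  h cancel on them.

  The series of the kernel does not converge absolutely, so domination by a summable sequence fails.
  An Abel factor \<rho>^k restores it, with final bounds uniform in \<rho>; this parameter is
  unrelated to the radius r. Both limits, \<rho> to 1 and r to 1, are taken in sums of finitely many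
  terms, where they are mere continuity, and the number of terms grows last.

  Three weights of order 1/k meet: 1/k from the kernel, (1 + k^2)^(-1/2) from the norm, 1/(k + 1)
  from the area integral. They are comparable for k >= 1; frequency 0, which the kernel does not
  see, is bounded directly by the L^1 norm.\<close>

section \<open>Fourier series on the circle\<close>

text \<open>Dominated termwise integration: the k-th term is at most |c k| B |g|, integrable in x
  and summable in k. Since the \<open>e k\<close> are uniformly bounded, \<open>g\<close> may be
  merely integrable.\<close>

lemma sums_integral_mult_suminf:
  fixes g :: "'a \<Rightarrow> complex" and c :: "nat \<Rightarrow> complex"
  assumes g: "integrable M g" and e: "\<And>k. e k \<in> borel_measurable M"
    and B: "\<And>k x. x \<in> space M \<Longrightarrow> cmod (e k x) \<le> B" and c: "summable (\<lambda>k. cmod (c k))"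
  shows "(\<lambda>k. c k * (\<integral>x. g x * e k x \<partial>M)) sums (\<integral>x. g x * (\<Sum>k. c k * e k x) \<partial>M)"
    and "integrable M (\<lambda>x. g x * (\<Sum>k. c k * e k x))"
proof -
  have ge: "integrable M (\<lambda>x. g x * e k x)" for k
  proof (rule Bochner_Integration.integrable_bound)
    show "integrable M (\<lambda>x. B * cmod (g x))" using g by auto
    show "(\<lambda>x. g x * e k x) \<in> borel_measurable M" using g e by measurable
    show "AE x in M. norm (g x * e k x) \<le> norm (B * cmod (g x))"
    proof (rule AE_I2)
      fix x assume x: "x \<in> space M"
      from B[OF x, of k] have "0 \<le> B" by (meson norm_ge_zero order_trans)
      then show "norm (g x * e k x) \<le> norm (B * cmod (g x))"
        using B[OF x, of k] mult_right_mono[of "cmod (e k x)" B "cmod (g x)"] by (simp add: norm_mult mult.commute)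
    qed
  qed
  have int: "integrable M (\<lambda>x. c k * (g x * e k x))" for k using ge by auto
  have s: "summable (\<lambda>k. norm (c k * (g x * e k x)))" if "x \<in> space M" for x
  proof (rule summable_comparison_test')
    show "summable (\<lambda>k. cmod (c k) * (cmod (g x) * B))" using c by (rule summable_mult2)
    show "norm (norm (c k * (g x * e k x))) \<le> cmod (c k) * (cmod (g x) * B)" for k
      using B[OF that, of k] by (simp add: norm_mult mult_left_mono)
  qed
  have s2: "summable (\<lambda>k. \<integral>x. norm (c k * (g x * e k x)) \<partial>M)"
  proof (rule summable_comparison_test')
    show "summable (\<lambda>k. cmod (c k) * (\<integral>x. cmod (g x) * B \<partial>M))" using c by (rule summable_mult2)
    fix k
    have "(\<integral>x. norm (c k * (g x * e k x)) \<partial>M) \<le> (\<integral>x. cmod (c k) * (cmod (g x) * B) \<partial>M)"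
      using int B g by (intro integral_mono integrable_norm) (auto simp: norm_mult mult_left_mono)
    then show "norm (\<integral>x. norm (c k * (g x * e k x)) \<partial>M) \<le> cmod (c k) * (\<integral>x. cmod (g x) * B \<partial>M)"
      by (simp add: integral_nonneg_AE)
  qed
  have eq: "(\<Sum>k. c k * (g x * e k x)) = g x * (\<Sum>k. c k * e k x)" if "x \<in> space M" for x
  proof (cases "g x = 0")
    case False
    have "summable (\<lambda>k. c k * (g x * e k x))" using s[OF that] by (rule summable_norm_cancel)
    then have "summable (\<lambda>k. inverse (g x) * (c k * (g x * e k x)))" by (rule summable_mult)
    then have "summable (\<lambda>k. c k * e k x)" using False by (simp add: field_simps)
    then show ?thesis by (simp add: suminf_mult[symmetric] algebra_simps)
  qed auto
  note I = sums_integral[OF int AE_I2[OF s] s2] integrable_suminf[OF int AE_I2[OF s] s2]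
  show "(\<lambda>k. c k * (\<integral>x. g x * e k x \<partial>M)) sums (\<integral>x. g x * (\<Sum>k. c k * e k x) \<partial>M)"
    using I(1) eq by (simp cong: Bochner_Integration.integral_cong)
  show "integrable M (\<lambda>x. g x * (\<Sum>k. c k * e k x))"
    using I(2) eq by (simp cong: Bochner_Integration.integrable_cong)
qed

abbreviation circle :: "real measure" where
  "circle \<equiv> lebesgue_on {0..2*pi}"

lemma finite_measure_circle: "finite_measure circle"
  by (rule finite_measure_lebesgue_on) (simp add: lmeasurable_interval)

lemma space_circle [simp]: "space circle = {0..2*pi}"
  by simp

lemma continuous_circle_integrable:
  fixes F :: "real \<Rightarrow> complex"
  assumes "continuous_on UNIV F"
  shows "integrable circle F"
proof -
  have "F absolutely_integrable_on {0..2*pi}"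
    by (rule absolutely_integrable_continuous_real) (rule continuous_on_subset[OF assms], simp)
  then show ?thesis by (simp add: absolutely_integrable_on_def integrable_restrict_space set_integrable_def)
qed

lemma measurable_circle_cis [measurable]: "(\<lambda>\<theta>. cis (c * \<theta>)) \<in> borel_measurable circle"
  by (rule borel_measurable_integrable, rule continuous_circle_integrable) (intro continuous_intros)

lemma integral_circle_cis:
  "(\<integral>\<theta>. cis (of_int m * \<theta>) \<partial>circle) = (if m = 0 then of_real (2 * pi) else 0)"
proof -
  have "(\<integral>\<theta>. cis (of_int m * \<theta>) \<partial>circle) = integral {0..2*pi} (\<lambda>\<theta>. cis (of_int m * \<theta>))"
    by (rule lebesgue_integral_eq_integral)
       (auto intro!: continuous_circle_integrable continuous_intros)
  also have "\<dots> = (if m = 0 then of_real (2 * pi) else 0)"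
  proof (cases "m = 0")
    case True then show ?thesis by (simp add: scaleR_conv_of_real)
  next
    case False
    have "((\<lambda>\<theta>. cis (of_int m * \<theta>)) has_integral
       (cis (of_int m * (2*pi)) / (\<i> * of_int m) - cis (of_int m * 0) / (\<i> * of_int m))) {0..2*pi}"
    proof (rule fundamental_theorem_of_calculus)
      fix x :: real
      have "((\<lambda>z. exp (\<i> * of_int m * z) / (\<i> * of_int m)) has_field_derivative exp (\<i> * of_int m * of_real x))
         (at (of_real x))"
        using False by (auto intro!: derivative_eq_intros)
      from has_vector_derivative_real_field[OF this, of UNIV]
      show "((\<lambda>\<theta>. cis (of_int m * \<theta>) / (\<i> * of_int m)) has_vector_derivative cis (of_int m * x))
         (at x within {0..2*pi})"
        by (auto simp: o_def cis_conv_exp mult_ac intro: has_vector_derivative_at_within)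
    qed simp
    moreover have "cis (of_int m * (2*pi)) = 1"
      using cis_multiple_2pi[of "of_int m"] by (simp add: mult_ac)
    ultimately show ?thesis using False by (auto dest!: integral_unique)
  qed
  finally show ?thesis .
qed

text \<open>Left without the factor 1 / (2 pi), so that the L^1 norm bounds every coefficient with
  constant 1; the factor enters only on passing to \<open>fourier_coeff\<close>.\<close>

definition circle_coeff :: "(real \<Rightarrow> complex) \<Rightarrow> int \<Rightarrow> complex" where
  "circle_coeff g k = (\<integral>\<theta>. g \<theta> * cis (- of_int k * \<theta>) \<partial>circle)"

lemma fourier_coeff_distribution_of:
  "fourier_coeff (distribution_of g) k = circle_coeff g k / of_real (2 * pi)"
proof -
  have "exp (- \<i> * of_int k * of_real \<theta>) = cis (- of_int k * \<theta>)" for \<theta>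
    by (simp add: cis_conv_exp mult.assoc)
  then show ?thesis unfolding fourier_coeff_def distribution_of_def circle_coeff_def
    by (simp add: set_lebesgue_integral_def integral_restrict_space)
qed

lemma cmod_circle_coeff_le:
  assumes "integrable circle g"
  shows "cmod (circle_coeff g k) \<le> (\<integral>\<theta>. cmod (g \<theta>) \<partial>circle)"
  unfolding circle_coeff_def
  using integral_norm_bound[of circle "\<lambda>\<theta>. g \<theta> * cis (- of_int k * \<theta>)"] by (simp add: norm_mult)

lemma cnj_circle_coeff:
  "cnj (circle_coeff g k) = (\<integral>\<theta>. cnj (g \<theta>) * cis (of_int k * \<theta>) \<partial>circle)"
  unfolding circle_coeff_def by (simp flip: Bochner_Integration.integral_cnj add: cis_cnj)

lemma continuous_cis_series:
  assumes b: "summable (\<lambda>n. cmod (b n))"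
  shows "continuous_on UNIV (\<lambda>\<theta>. \<Sum>n. b n * cis (of_nat n * \<theta>))"
proof -
  have "uniform_limit UNIV (\<lambda>N \<theta>. \<Sum>n<N. b n * cis (of_nat n * \<theta>)) (\<lambda>\<theta>. \<Sum>n. b n * cis (of_nat n * \<theta>)) sequentially"
    by (rule Weierstrass_m_test[OF _ b]) (simp add: norm_mult)
  then show ?thesis
    by (rule uniform_limit_theorem[rotated])
       (auto intro!: always_eventually continuous_intros)
qed

text \<open>Orthogonality of the exponentials, applied term by term. The value 0 at negative
  \<open>k\<close> is how analyticity enters the norm estimate.\<close>

lemma circle_coeff_cis_series:
  assumes b: "summable (\<lambda>n. cmod (b n))"
  shows "circle_coeff (\<lambda>\<theta>. \<Sum>n. b n * cis (of_nat n * \<theta>)) k =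
    (if k \<ge> 0 then of_real (2 * pi) * b (nat k) else 0)"
proof -
  let ?e = "\<lambda>n \<theta>. cis (of_int (int n) * \<theta>)"
  have "(\<lambda>n. b n * (\<integral>\<theta>. cis (- of_int k * \<theta>) * ?e n \<theta> \<partial>circle)) sums
     (\<integral>\<theta>. cis (- of_int k * \<theta>) * (\<Sum>n. b n * ?e n \<theta>) \<partial>circle)"
    by (rule sums_integral_mult_suminf(1)[where B = 1])
       (auto intro!: continuous_circle_integrable continuous_intros b)
  moreover have "(\<integral>\<theta>. cis (- of_int k * \<theta>) * ?e n \<theta> \<partial>circle) = (if k = int n then of_real (2 * pi) else 0)" for n
    using integral_circle_cis[of "int n - k"] by (auto simp: cis_mult algebra_simps)
  moreover have "(\<lambda>n. b n * (if k = int n then of_real (2 * pi) else 0)) sums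
      (if k \<ge> 0 then of_real (2 * pi) * b (nat k) else 0)"
  proof (cases "k \<ge> 0")
    case True
    then have "(\<lambda>n. b n * (if k = int n then of_real (2 * pi) else 0)) =
        (\<lambda>n. if n = nat k then of_real (2 * pi) * b n else 0)" by auto
    then show ?thesis using True sums_single[of "nat k" "\<lambda>n. of_real (2*pi) * b n"] by simp
  qed (auto intro: sums_zero simp: if_distrib cong: if_cong)
  ultimately show ?thesis
    unfolding circle_coeff_def by (auto dest: sums_unique2 simp: mult.commute)
qed

text \<open>Absolute summability makes the sum F continuous, so no completeness of L^2 is involved:
  integrating the conjugate of F against the series of F term by term produces the conjugate
  coefficients.\<close>

lemma parseval_cis_series:
  assumes b: "summable (\<lambda>n. cmod (b n))"
  shows "(\<integral>\<^sup>+\<theta>. ennreal ((cmod (\<Sum>n. b n * cis (of_nat n * \<theta>)))\<^sup>2) \<partial>circle) =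
    (\<Sum>n. ennreal (2 * pi * (cmod (b n))\<^sup>2))"
proof -
  define F where "F = (\<lambda>\<theta>. \<Sum>n. b n * cis (of_nat n * \<theta>))"
  have F: "continuous_on UNIV F" unfolding F_def by (rule continuous_cis_series[OF b])
  let ?e = "\<lambda>n \<theta>. cis (of_int (int n) * \<theta>)"
  have "(\<lambda>n. b n * (\<integral>\<theta>. cnj (F \<theta>) * ?e n \<theta> \<partial>circle)) sums
     (\<integral>\<theta>. cnj (F \<theta>) * (\<Sum>n. b n * ?e n \<theta>) \<partial>circle)"
    by (rule sums_integral_mult_suminf(1)[where B = 1])
       (auto intro!: continuous_circle_integrable continuous_intros b F)
  moreover have "b n * (\<integral>\<theta>. cnj (F \<theta>) * ?e n \<theta> \<partial>circle) = of_real (2 * pi * (cmod (b n))\<^sup>2)" for n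
    unfolding cnj_circle_coeff[symmetric] using circle_coeff_cis_series[OF b, of "int n"]
      complex_norm_square[of "b n"] by (simp add: F_def mult_ac)
  moreover have "cnj (F \<theta>) * (\<Sum>n. b n * ?e n \<theta>) = of_real ((cmod (F \<theta>))\<^sup>2)" for \<theta>
    unfolding complex_norm_square by (simp add: F_def mult.commute)
  ultimately have s: "(\<lambda>n. 2 * pi * (cmod (b n))\<^sup>2) sums (\<integral>\<theta>. (cmod (F \<theta>))\<^sup>2 \<partial>circle)"
    by (simp only: integral_complex_of_real sums_of_real_iff)
  have "integrable circle (\<lambda>\<theta>. complex_of_real ((cmod (F \<theta>))\<^sup>2))"
    by (intro continuous_circle_integrable continuous_intros F)
  then have "integrable circle (\<lambda>\<theta>. (cmod (F \<theta>))\<^sup>2)" by (simp only: complex_of_real_integrable_eq)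
  then have "(\<integral>\<^sup>+\<theta>. ennreal ((cmod (F \<theta>))\<^sup>2) \<partial>circle) = ennreal (\<integral>\<theta>. (cmod (F \<theta>))\<^sup>2 \<partial>circle)"
    by (intro nn_integral_eq_integral) auto
  also have "\<dots> = (\<Sum>n. ennreal (2 * pi * (cmod (b n))\<^sup>2))"
    using s by (subst suminf_ennreal_eq[where x = "\<integral>\<theta>. (cmod (F \<theta>))\<^sup>2 \<partial>circle"]) auto
  finally show ?thesis by (simp add: F_def)
qed

section \<open>Rotations and radial integrals in the plane\<close>

text \<open>Both measures give a box the product of its side lengths, and this determines Lebesgue
  measure. It provides iterated integrals over real and imaginary parts in either order.\<close>

lemma lborel_complex_eq: "lborel = distr (lborel \<Otimes>\<^sub>M lborel) borel (\<lambda>(x, y). Complex x y)"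
proof (rule lborel_eqI)
  have m: "(\<lambda>(x, y). Complex x y) \<in> borel_measurable (lborel \<Otimes>\<^sub>M lborel)"
    by (simp add: Complex_eq split_beta')
  fix l u :: complex
  assume "\<And>b. b \<in> Basis \<Longrightarrow> l \<bullet> b \<le> u \<bullet> b"
  then have le: "Re l \<le> Re u" "Im l \<le> Im u"
    by (force simp: Basis_complex_def)+
  have "(\<lambda>(x, y). Complex x y) -` box l u \<inter> space (lborel \<Otimes>\<^sub>M lborel) =
      {Re l<..<Re u} \<times> {Im l<..<Im u}"
    by (auto simp: space_pair_measure in_box_complex_iff)
  then show "emeasure (distr (lborel \<Otimes>\<^sub>M lborel) borel (\<lambda>(x, y). Complex x y)) (box l u) =
      (\<Prod>b\<in>Basis. (u - l) \<bullet> b)"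
    using le by (simp add: emeasure_distr[OF m] lborel.emeasure_pair_measure_Times Basis_complex_def
      ennreal_mult)
qed simp

lemma nn_integral_lborel_complex:
  fixes h :: "complex \<Rightarrow> ennreal"
  assumes h [measurable]: "h \<in> borel_measurable borel"
  shows "(\<integral>\<^sup>+z. h z \<partial>lborel) = (\<integral>\<^sup>+x. \<integral>\<^sup>+y. h (Complex x y) \<partial>lborel \<partial>lborel)"
    and "(\<integral>\<^sup>+z. h z \<partial>lborel) = (\<integral>\<^sup>+y. \<integral>\<^sup>+x. h (Complex x y) \<partial>lborel \<partial>lborel)"
proof -
  have m [measurable]: "(\<lambda>(x, y). Complex x y) \<in> borel_measurable (lborel \<Otimes>\<^sub>M lborel)"
    by (simp add: Complex_eq split_beta')
  have hm: "(\<lambda>p. h (Complex (fst p) (snd p))) \<in> borel_measurable (lborel \<Otimes>\<^sub>M lborel)"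
    using measurable_compose[OF m h] by (simp add: split_beta')
  have "(\<integral>\<^sup>+z. h z \<partial>lborel) = (\<integral>\<^sup>+p. h (Complex (fst p) (snd p)) \<partial>(lborel \<Otimes>\<^sub>M lborel))"
    by (subst lborel_complex_eq, subst nn_integral_distr) (auto simp: split_beta')
  then show "(\<integral>\<^sup>+z. h z \<partial>lborel) = (\<integral>\<^sup>+x. \<integral>\<^sup>+y. h (Complex x y) \<partial>lborel \<partial>lborel)"
    and "(\<integral>\<^sup>+z. h z \<partial>lborel) = (\<integral>\<^sup>+y. \<integral>\<^sup>+x. h (Complex x y) \<partial>lborel \<partial>lborel)"
    using lborel.nn_integral_fst[OF hm] lborel_pair.nn_integral_snd[OF hm]
    by (simp_all add: split_beta')
qed

lemma borel_measurable_Complex [measurable (raw)]: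
  assumes "f \<in> borel_measurable M" "g \<in> borel_measurable M"
  shows "(\<lambda>x. Complex (f x) (g x)) \<in> borel_measurable M"
  using assms by (simp add: Complex_eq)

lemma nn_integral_translate:
  fixes f :: "real \<Rightarrow> ennreal"
  assumes "f \<in> borel_measurable borel"
  shows "(\<integral>\<^sup>+x. f (x + t) \<partial>lborel) = (\<integral>\<^sup>+x. f x \<partial>lborel)"
  using nn_integral_real_affine[of f 1 t] assms by (simp add: add.commute)

text \<open>With the other coordinate fixed, a shear translates a real line, so the iterated
  integral is taken with the moving coordinate innermost.\<close>

lemma nn_integral_shear:
  fixes h :: "complex \<Rightarrow> ennreal"
  assumes h [measurable]: "h \<in> borel_measurable borel"
  shows "(\<integral>\<^sup>+z. h (Complex (Re z + s * Im z) (Im z)) \<partial>lborel) = (\<integral>\<^sup>+z. h z \<partial>lborel)"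
    and "(\<integral>\<^sup>+z. h (Complex (Re z) (Im z + s * Re z)) \<partial>lborel) = (\<integral>\<^sup>+z. h z \<partial>lborel)"
   apply (subst nn_integral_lborel_complex(2), measurable)
   apply (simp add: nn_integral_lborel_complex(2)[OF h] nn_integral_translate[where f = "\<lambda>x. h (Complex x _)"])
  apply (subst nn_integral_lborel_complex(1), measurable)
  apply (simp add: nn_integral_lborel_complex(1)[OF h] nn_integral_translate[where f = "\<lambda>y. h (Complex _ y)"])
  done

text \<open>A rotation with nonzero sine is a product of three shears, and every rotation is the square
  of such a rotation or trivial.\<close>

lemma nn_integral_rotate_nonreal:
  fixes h :: "complex \<Rightarrow> ennreal"
  assumes h [measurable]: "h \<in> borel_measurable borel" and c: "cmod c = 1" "Im c \<noteq> 0"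
  shows "(\<integral>\<^sup>+z. h (c * z) \<partial>lborel) = (\<integral>\<^sup>+z. h z \<partial>lborel)"
proof -
  \<comment> \<open>For the rotation by t the factors are two horizontal shears by s = (cos t - 1) /
    sin t = - tan (t / 2) around a vertical one by sin t.\<close>
  define a b s where "a = Re c" and "b = Im c" and "s = (a - 1) / b"
  have ab: "a\<^sup>2 + b\<^sup>2 = 1" "b \<noteq> 0" using c by (auto simp: a_def b_def cmod_def)
  have sb: "s * b = a - 1" "b * s = a - 1" using ab by (auto simp: s_def)
  have sa: "s * (1 + a) = - b"
  proof -
    have "b * (s * (1 + a)) = (b * s) * (1 + a)" by simp
    also have "\<dots> = b * (- b)" unfolding sb using ab by (simp add: power2_eq_square algebra_simps)
    finally have "b * (s * (1 + a)) = b * (- b)" .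
    then show ?thesis using ab by (simp only: mult_cancel_left) simp
  qed
  have eq: "c * z = Complex (Re z + s * Im z + s * (Im z + b * (Re z + s * Im z))) (Im z + b * (Re z + s * Im z))" for z
  proof (rule complex_eqI)
    have "Re z + s * Im z + s * (Im z + b * (Re z + s * Im z)) = (1 + s * b) * Re z + (s * (1 + (1 + s * b))) * Im z"
      by (simp add: algebra_simps)
    also have "\<dots> = Re (c * z)" using sb sa by (simp add: a_def b_def algebra_simps)
    finally show "Re (c * z) = Re (Complex (Re z + s * Im z + s * (Im z + b * (Re z + s * Im z))) (Im z + b * (Re z + s * Im z)))"
      by simp
    have "Im z + b * (Re z + s * Im z) = b * Re z + (1 + b * s) * Im z" by (simp add: algebra_simps)
    then show "Im (c * z) = Im (Complex (Re z + s * Im z + s * (Im z + b * (Re z + s * Im z))) (Im z + b * (Re z + s * Im z)))"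
      using sb by (simp add: a_def b_def)
  qed
  define h1 where "h1 = (\<lambda>z. h (Complex (Re z + s * Im z) (Im z)))"
  define h2 where "h2 = (\<lambda>z. h1 (Complex (Re z) (Im z + b * Re z)))"
  have [measurable]: "h1 \<in> borel_measurable borel" "h2 \<in> borel_measurable borel"
    unfolding h2_def h1_def by measurable
  have "(\<integral>\<^sup>+z. h (c * z) \<partial>lborel) = (\<integral>\<^sup>+z. h2 (Complex (Re z + s * Im z) (Im z)) \<partial>lborel)"
    by (simp add: eq h2_def h1_def)
  also have "\<dots> = (\<integral>\<^sup>+z. h z \<partial>lborel)"
    unfolding nn_integral_shear(1)[of h2 s, simplified] unfolding h2_def
    unfolding nn_integral_shear(2)[of h1 b, simplified] unfolding h1_def
    by (rule nn_integral_shear(1)) simp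
  finally show ?thesis .
qed

lemma nn_integral_rotate:
  fixes h :: "complex \<Rightarrow> ennreal"
  assumes h [measurable]: "h \<in> borel_measurable borel" and c: "cmod c = 1"
  shows "(\<integral>\<^sup>+z. h (c * z) \<partial>lborel) = (\<integral>\<^sup>+z. h z \<partial>lborel)"
proof (cases "Im c = 0")
  case False
  then show ?thesis using nn_integral_rotate_nonreal[OF h c] by simp
next
  case True
  then have "c = 1 \<or> c = - 1" using c by (auto simp: cmod_def complex_eq_iff abs_if split: if_splits)
  then show ?thesis
  proof
    assume "c = - 1"
    then have "c * z = \<i> * (\<i> * z)" for z by simp
    then have "(\<integral>\<^sup>+z. h (c * z) \<partial>lborel) = (\<integral>\<^sup>+z. h (\<i> * (\<i> * z)) \<partial>lborel)" by simp
    also have "\<dots> = (\<integral>\<^sup>+z. h (\<i> * z) \<partial>lborel)"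
      by (rule nn_integral_rotate_nonreal) auto
    also have "\<dots> = (\<integral>\<^sup>+z. h z \<partial>lborel)"
      by (rule nn_integral_rotate_nonreal) auto
    finally show ?thesis .
  qed simp
qed

text \<open>The annulus between radii r and 1 has area pi (1 - r^2), linear in r^2, so the squared
  modulus turns area into a constant density. Finite values on the half-lines \<open>{t<..}\<close>
  determine a measure.\<close>

lemma distr_disc_norm_square:
  "distr (restrict_space lborel (ball 0 1)) borel (\<lambda>z::complex. (cmod z)\<^sup>2) =
   density lborel (\<lambda>t. ennreal pi * indicator {0..1} t)" (is "?M = ?N")
proof (rule measure_eqI_lessThan)
  have m: "(\<lambda>z::complex. (cmod z)\<^sup>2) \<in> borel_measurable (restrict_space lborel (ball 0 1))"
    by (simp add: measurable_restrict_space1)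
  fix t :: real
  have "emeasure ?M {t<..} = emeasure lborel ({z::complex. (cmod z)\<^sup>2 > t} \<inter> ball 0 1)"
    by (subst emeasure_distr[OF m]) (auto simp: emeasure_restrict_space space_restrict_space intro!: arg_cong[where f = "emeasure lborel"])
  also have "\<dots> = ennreal (pi * (1 - max 0 (min t 1)))"
  proof (cases "t < 0")
    case True
    then have "{z::complex. (cmod z)\<^sup>2 > t} \<inter> ball 0 1 = ball 0 1"
      by (auto intro: less_le_trans)
    then show ?thesis using True by (simp add: emeasure_ball unit_ball_vol_2)
  next
    case False
    \<comment> \<open>Capping at 1 covers t >= 1 as well: then r = 1 and the annulus is
      empty.\<close>
    define r where "r = sqrt (min t 1)"
    have r: "0 \<le> r" "r \<le> 1" "r\<^sup>2 = min t 1" using False by (auto simp: r_def)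
    have "z \<in> ball 0 1 - cball 0 r" if "(cmod z)\<^sup>2 > t" "cmod z < 1" for z :: complex
    proof -
      have "r < cmod z" using that unfolding r_def
        by (intro real_less_lsqrt) (auto simp: min_def not_less)
      then show ?thesis using that by simp
    qed
    moreover have "(cmod z)\<^sup>2 > t" if "cmod z > r" "cmod z < 1" for z :: complex
    proof -
      have "r\<^sup>2 < (cmod z)\<^sup>2" "(cmod z)\<^sup>2 < 1" using that r power_strict_mono[of r "cmod z" 2] by (simp_all add: abs_square_less_1)
      then show ?thesis using r(3) by (auto simp: min_def split: if_splits)
    qed
    ultimately have eq: "{z::complex. (cmod z)\<^sup>2 > t} \<inter> ball 0 1 = ball 0 1 - cball 0 r" by auto
    show ?thesis
    proof (cases "t < 1")
      case True
      then have "r < 1" using False by (simp add: r_def)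
      have "emeasure lborel (ball 0 1 - cball (0::complex) r) =
         emeasure lborel (ball (0::complex) 1) - emeasure lborel (cball (0::complex) r)"
        using \<open>r < 1\<close> r(1) by (intro emeasure_Diff) (auto simp: emeasure_cball)
      also have "\<dots> = ennreal pi - ennreal (pi * r\<^sup>2)"
        using r by (simp add: emeasure_ball emeasure_cball unit_ball_vol_2)
      also have "\<dots> = ennreal (pi * (1 - r\<^sup>2))"
        by (subst ennreal_minus) (auto simp: algebra_simps)
      finally show ?thesis using eq r False True by simp
    next
      case False
      then have "r = 1" by (simp add: r_def)
      then have "ball 0 1 - cball (0::complex) r = {}" by auto
      then show ?thesis using False by (simp only: eq) simp
    qed
  qed
  finally have 1: "emeasure ?M {t<..} = ennreal (pi * (1 - max 0 (min t 1)))" .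
  have "emeasure ?N {t<..} = (\<integral>\<^sup>+x. ennreal pi * indicator ({t<..} \<inter> {0..1}) x \<partial>lborel)"
    by (subst emeasure_density) (auto intro!: nn_integral_cong simp: indicator_def)
  also have "\<dots> = ennreal pi * emeasure lborel ({t<..} \<inter> {0..1})"
    by (subst nn_integral_cmult_indicator) auto
  also have "emeasure lborel ({t<..} \<inter> {0..1}) = ennreal (1 - max 0 (min t 1))"
  proof -
    have "{t<..} \<inter> {0..1} = (if t < 0 then {0..1} else if t < 1 then {t<..1} else {})" by auto
    then show ?thesis by (auto simp: max_def min_def)
  qed
  finally show "emeasure ?M {t<..} = emeasure ?N {t<..}"
    using 1 by (simp add: ennreal_mult)
  show "emeasure ?M {t<..} < \<infinity>" using 1 by simp
qed simp_all

text \<open>In the variable t = |z|^2 this is pi times the integral of t^n over [0, 1], the origin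
  of the weight 1 / (n + 1).\<close>

lemma nn_integral_disc_norm_power:
  "(\<integral>\<^sup>+z\<in>ball 0 1. ennreal (cmod z ^ (2 * n)) \<partial>lborel) = ennreal (pi / (n + 1))"
proof -
  have "(\<integral>\<^sup>+z\<in>ball 0 1. ennreal (cmod z ^ (2 * n)) \<partial>lborel) =
     (\<integral>\<^sup>+z. ennreal (((cmod z)\<^sup>2) ^ n) \<partial>restrict_space lborel (ball 0 1))"
    by (subst nn_integral_restrict_space) (auto simp: power_mult)
  also have "\<dots> = (\<integral>\<^sup>+t. ennreal (t ^ n) \<partial>distr (restrict_space lborel (ball 0 1)) borel (\<lambda>z::complex. (cmod z)\<^sup>2))"
    by (subst nn_integral_distr) (auto simp: measurable_restrict_space1)
  also have "\<dots> = (\<integral>\<^sup>+t. ennreal pi * indicator {0..1} t * ennreal (t ^ n) \<partial>lborel)"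
    unfolding distr_disc_norm_square by (subst nn_integral_density) auto
  also have "\<dots> = (\<integral>\<^sup>+t. ennreal (pi * t ^ n) * indicator {0..1} t \<partial>lborel)"
    by (intro nn_integral_cong) (auto simp: indicator_def ennreal_mult)
  also have "\<dots> = ennreal (pi / (n + 1) * 1 ^ Suc n - pi / (n + 1) * 0 ^ Suc n)"
  proof (rule nn_integral_FTC_Icc)
    fix t :: real
    have "((\<lambda>t. pi / (n + 1) * t ^ Suc n) has_real_derivative pi / (n + 1) * (real (Suc n) * t ^ n)) (at t)"
      using DERIV_pow[of "Suc n" t] by (intro DERIV_cmult) simp
    then show "((\<lambda>t. pi / (n + 1) * t ^ Suc n) has_real_derivative pi * t ^ n) (at t)"
      by (simp add: add.commute)
  qed auto
  finally show ?thesis by simp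
qed

text \<open>All sums and integrals live in \<open>ennreal\<close>, so the identity includes the case
  where both sides are infinite and can serve both directions of the equivalence.\<close>

lemma nn_integral_disc_power_series:
  fixes f :: "complex \<Rightarrow> complex"
  assumes f: "f holomorphic_on ball 0 1"
    and sums: "\<And>z. z \<in> ball 0 1 \<Longrightarrow> (\<lambda>n. a n * z ^ n) sums f z"
    and abs: "\<And>z. z \<in> ball 0 1 \<Longrightarrow> summable (\<lambda>n. cmod (a n * z ^ n))"
  shows "(\<integral>\<^sup>+z\<in>ball 0 1. ennreal ((cmod (f z))\<^sup>2) \<partial>lebesgue) =
    ennreal pi * (\<Sum>n. ennreal ((cmod (a n))\<^sup>2 / (n + 1)))"
proof -
  \<comment> \<open>Extended by zero, the integrand is Borel on the whole plane, where rotation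
    invariance of \<open>lborel\<close> applies.\<close>
  define h where "h = (\<lambda>z. ennreal ((cmod (f z))\<^sup>2) * indicator (ball 0 1) z)"
  have "(\<lambda>z. if z \<in> ball 0 1 then f z else 0) \<in> borel_measurable borel"
    by (rule borel_measurable_continuous_on_if)
       (auto intro!: holomorphic_on_imp_continuous_on f continuous_intros)
  then have "(\<lambda>z. ennreal ((cmod (if z \<in> ball 0 1 then f z else 0))\<^sup>2)) \<in> borel_measurable borel"
    by measurable
  moreover have "h = (\<lambda>z. ennreal ((cmod (if z \<in> ball 0 1 then f z else 0))\<^sup>2))"
    by (auto simp: h_def indicator_def)
  ultimately have h [measurable]: "h \<in> borel_measurable borel" by simp
  interpret sigma_finite_measure circle
    using finite_measure_circle by (rule finite_measure.axioms)
  interpret pair_sigma_finite circle "lborel :: complex measure" ..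
  have m: "(\<lambda>p. h (cis (fst p) * snd p)) \<in> borel_measurable (circle \<Otimes>\<^sub>M lborel)"
  proof -
    have [measurable]: "(\<lambda>p. cis (fst p)) \<in> borel_measurable (circle \<Otimes>\<^sub>M (lborel :: complex measure))"
      using measurable_compose[OF measurable_fst measurable_circle_cis[of 1], of lborel] by simp
    show ?thesis by measurable
  qed
  have J: "(\<integral>\<^sup>+z\<in>ball 0 1. ennreal ((cmod (f z))\<^sup>2) \<partial>lebesgue) = (\<integral>\<^sup>+z. h z \<partial>lborel)"
    unfolding h_def by (rule nn_integral_completion)
  \<comment> \<open>The constant is spread over the circle and the plane is rotated by each
    \<theta>; after Tonelli the inner integral runs over the circle through z, which is where
    Parseval applies.\<close>
  have "ennreal (2 * pi) * (\<integral>\<^sup>+z. h z \<partial>lborel) = (\<integral>\<^sup>+\<theta>. (\<integral>\<^sup>+z. h z \<partial>lborel) \<partial>circle)"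
    by (simp add: emeasure_restrict_space mult.commute)
  also have "\<dots> = (\<integral>\<^sup>+\<theta>. (\<integral>\<^sup>+z. h (cis \<theta> * z) \<partial>lborel) \<partial>circle)"
    by (simp add: nn_integral_rotate)
  also have "\<dots> = (\<integral>\<^sup>+z. (\<integral>\<^sup>+\<theta>. h (cis \<theta> * z) \<partial>circle) \<partial>lborel)"
    using Fubini'[of "\<lambda>\<theta> z. h (cis \<theta> * z)"] m by (simp add: split_beta')
  also have "\<dots> = (\<integral>\<^sup>+z. (\<Sum>n. ennreal (2 * pi * (cmod (a n))\<^sup>2) * (ennreal (cmod z ^ (2 * n)) * indicator (ball 0 1) z)) \<partial>lborel)"
  proof (intro nn_integral_cong)
    fix z :: complex
    show "(\<integral>\<^sup>+\<theta>. h (cis \<theta> * z) \<partial>circle) =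
      (\<Sum>n. ennreal (2 * pi * (cmod (a n))\<^sup>2) * (ennreal (cmod z ^ (2 * n)) * indicator (ball 0 1) z))"
    proof (cases "z \<in> ball 0 1")
      case True
      have "f (cis \<theta> * z) = (\<Sum>n. (a n * z ^ n) * cis (of_nat n * \<theta>))" for \<theta>
        using sums_unique[OF sums[of "cis \<theta> * z"]] True
        by (simp add: norm_mult power_mult_distrib Complex.DeMoivre mult_ac)
      then have "h (cis \<theta> * z) = ennreal ((cmod (\<Sum>n. (a n * z ^ n) * cis (of_nat n * \<theta>)))\<^sup>2)" for \<theta>
        using True by (simp add: h_def norm_mult)
      then have "(\<integral>\<^sup>+\<theta>. h (cis \<theta> * z) \<partial>circle) = (\<Sum>n. ennreal (2 * pi * (cmod (a n * z ^ n))\<^sup>2))"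
        using parseval_cis_series[OF abs[OF True]] by simp
      also have "\<dots> = (\<Sum>n. ennreal (2 * pi * (cmod (a n))\<^sup>2) * (ennreal (cmod z ^ (2 * n)) * indicator (ball 0 1) z))"
        using True unfolding power_even_eq
        by (simp add: norm_mult norm_power power_mult_distrib ennreal_mult[symmetric] mult_ac)
      finally show ?thesis .
    qed (simp add: h_def norm_mult)
  qed
  also have "\<dots> = (\<Sum>n. ennreal (2 * pi * (cmod (a n))\<^sup>2) * (\<integral>\<^sup>+z\<in>ball 0 1. ennreal (cmod z ^ (2 * n)) \<partial>lborel))"
  proof -
    have "(\<lambda>z::complex. ennreal (cmod z ^ (2 * n)) * indicator (ball 0 1) z) \<in> borel_measurable lborel" for n
      by (intro borel_measurable_times_ennreal borel_measurable_indicator) auto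
    then show ?thesis
      by (subst nn_integral_suminf) (auto intro!: suminf_cong nn_integral_cmult)
  qed
  also have "\<dots> = (\<Sum>n. ennreal (2 * pi) * (ennreal pi * ennreal ((cmod (a n))\<^sup>2 / (n + 1))))"
    by (intro suminf_cong, subst nn_integral_disc_norm_power)
       (simp add: ennreal_mult[symmetric])
  also have "\<dots> = ennreal (2 * pi) * (ennreal pi * (\<Sum>n. ennreal ((cmod (a n))\<^sup>2 / (n + 1))))"
    by (simp add: ennreal_suminf_cmult)
  finally have "ennreal (2 * pi) * (\<integral>\<^sup>+z. h z \<partial>lborel) = \<dots>" .
  then show ?thesis unfolding J by (subst (asm) ennreal_mult_cancel_left) auto
qed

section \<open>The sawtooth kernel\<close>

text \<open>For z = \<rho> e^(it) the sum is minus the principal argument of 1 - z, which stays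
  within pi however close z comes to 1.\<close>

lemma abel_sine_sum_bound:
  assumes "0 \<le> \<rho>" "\<rho> < 1"
  shows "cmod (\<Sum>k. of_real (\<rho> ^ k / k) * of_real (sin (of_nat k * t))) \<le> pi"
proof -
  define z where "z = of_real \<rho> * cis t"
  have z: "cmod z < 1" using assms by (simp add: z_def norm_mult)
  \<comment> \<open>The term k = 0 is 1 / 0 = 0 by convention, so sums over all natural numbers
    effectively start at 1; the same holds for all sums with weight \<rho>^k / k below.\<close>
  have "(\<lambda>k. - (z ^ k) / of_nat k) sums ln (1 - z)"
    using Ln_series'[of "- z"] z by simp
  then have "(\<lambda>k. - (- (z ^ k) / of_nat k)) sums (- ln (1 - z))" by (rule sums_minus)
  from sums_Im[OF this] have "(\<lambda>k. Im (z ^ k / of_nat k)) sums (- Im (ln (1 - z)))" by simp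
  moreover have "Im (z ^ k / of_nat k) = \<rho> ^ k / k * sin (of_nat k * t)" for k
    by (simp add: z_def power_mult_distrib Complex.DeMoivre Im_divide_of_nat flip: of_real_power)
  ultimately have "(\<lambda>k. \<rho> ^ k / k * sin (of_nat k * t)) sums (- Im (ln (1 - z)))" by (simp only:)
  then have "(\<lambda>k. complex_of_real (\<rho> ^ k / k * sin (of_nat k * t))) sums of_real (- Im (ln (1 - z)))"
    by (rule sums_of_real)
  then have "(\<Sum>k. of_real (\<rho> ^ k / k) * of_real (sin (of_nat k * t))) = complex_of_real (- Im (ln (1 - z)))"
    by (simp add: sums_iff)
  moreover have "1 - z \<noteq> 0" using z by auto
  then have "\<bar>Im (ln (1 - z))\<bar> \<le> pi"
    using mpi_less_Im_Ln[of "1 - z"] Im_Ln_le_pi[of "1 - z"] by simp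
  ultimately show ?thesis by (metis abs_minus_cancel norm_of_real)
qed

lemma summable_power_div:
  assumes "0 \<le> \<rho>" "\<rho> < (1::real)"
  shows "summable (\<lambda>k. \<rho> ^ k / real k)"
proof (rule summable_comparison_test')
  show "summable (\<lambda>k. \<rho> ^ k)" using assms by (intro summable_geometric) auto
  fix k :: nat
  show "norm (\<rho> ^ k / real k) \<le> \<rho> ^ k"
    using assms mult_left_mono[of 1 "real k" "\<rho> ^ k"] by (cases "k = 0") (auto simp: divide_le_eq)
qed

text \<open>The kernel \<open>\<Sum> \<rho>\<^sup>k/k (e\<^sup>i\<^sup>k\<^sup>t - e\<^sup>-\<^sup>i\<^sup>k\<^sup>t)\<close> is bounded uniformly in \<open>\<rho>\<close>, although the two halves are not.\<close>

lemma abel_coeff_difference: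
  assumes g: "integrable circle g" and \<rho>: "0 \<le> \<rho>" "\<rho> < 1"
  defines "G \<equiv> \<integral>\<theta>. cmod (g \<theta>) \<partial>circle"
  shows "\<bar>\<Sum>k. \<rho> ^ k / k * ((cmod (circle_coeff g (int k)))\<^sup>2 - (cmod (circle_coeff g (- int k)))\<^sup>2)\<bar>
     \<le> 2 * pi * G\<^sup>2"
proof -
  define P where "P = (\<lambda>k::nat. circle_coeff g (int k))"
  define Q where "Q = (\<lambda>k::nat. circle_coeff g (- int k))"
  have G: "G \<ge> 0" by (simp add: G_def integral_nonneg_AE)
  have P: "cmod (P k) \<le> G" and Q: "cmod (Q k) \<le> G" for k
    using cmod_circle_coeff_le[OF g] by (simp_all add: P_def Q_def G_def)
  define c where "c = (\<lambda>k::nat. complex_of_real (\<rho> ^ k / k))"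
  have c: "summable (\<lambda>k. cmod (c k))"
    using summable_power_div[OF \<rho>] \<rho> by (simp add: c_def norm_divide norm_power)
  \<comment> \<open>\<open>e k\<close> serves two computations. Integrated against g it yields |P
    k|^2 - |Q k|^2, and it is itself the integral of the conjugate of g against 2 i sin (k (\<phi> -
    \<theta>)). The double integral of the form is thus treated as two single ones, each integrated
    termwise.\<close>
  define e where "e = (\<lambda>k \<theta>. cis (- of_int (int k) * \<theta>) * cnj (P k) - cis (- of_int (- int k) * \<theta>) * cnj (Q k))"
  have e_meas: "e k \<in> borel_measurable circle" for k
    unfolding e_def by (intro borel_measurable_diff borel_measurable_times measurable_circle_cis) auto
  have e_bound: "cmod (e k \<theta>) \<le> 2 * G" for k \<theta>
    unfolding e_def by (rule order_trans[OF norm_triangle_ineq4]) (use P[of k] Q[of k] in \<open>simp add: norm_mult\<close>)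
  \<comment> \<open>Adding up \<open>e_bound\<close> term by term would cost a factor - log (1 -
    \<rho>). Summing the sines under the integral first gives a bound free of \<rho>.\<close>
  have kernel: "cmod (\<Sum>k. c k * e k \<theta>) \<le> 2 * pi * G" for \<theta>
  proof -
    define s where "s = (\<lambda>(k::nat) \<phi>. complex_of_real (sin (of_nat k * (\<phi> - \<theta>))))"
    have eq: "(\<integral>\<phi>. (2 * \<i> * cnj (g \<phi>)) * s k \<phi> \<partial>circle) = e k \<theta>" for k
    proof -
      have i: "integrable circle (\<lambda>\<phi>. cnj (g \<phi>) * cis (of_int m * \<phi>))" for m
      proof (rule Bochner_Integration.integrable_bound[of _ g])
        show "(\<lambda>\<phi>. cnj (g \<phi>) * cis (of_int m * \<phi>)) \<in> borel_measurable circle"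
          using borel_measurable_integrable[of circle "\<lambda>\<phi>. cnj (g \<phi>)"] g
          by (intro borel_measurable_times measurable_circle_cis) auto
      qed (use g in \<open>auto simp: norm_mult\<close>)
      \<comment> \<open>This is 2 i sin x = e^(ix) - e^(-ix) at x = k (\<phi> - \<theta>), with the
        variables separated.\<close>
      have sk: "2 * \<i> * s k \<phi> = cis (- of_int (int k) * \<theta>) * cis (of_int (int k) * \<phi>)
           - cis (- of_int (- int k) * \<theta>) * cis (of_int (- int k) * \<phi>)" for \<phi>
        by (rule complex_eqI) (simp_all add: s_def cis_mult algebra_simps sin_diff cos_diff)
      have "(2 * \<i> * cnj (g \<phi>)) * s k \<phi> = cnj (g \<phi>) * (2 * \<i> * s k \<phi>)" for \<phi> by simp
      then have "(2 * \<i> * cnj (g \<phi>)) * s k \<phi> =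
          cis (- of_int (int k) * \<theta>) * (cnj (g \<phi>) * cis (of_int (int k) * \<phi>))
           - cis (- of_int (- int k) * \<theta>) * (cnj (g \<phi>) * cis (of_int (- int k) * \<phi>))" for \<phi>
        by (simp only: sk right_diff_distrib mult.left_commute)
      then show ?thesis
        unfolding e_def P_def Q_def cnj_circle_coeff
        by (simp only: Bochner_Integration.integral_diff integrable_mult_right i integral_mult_right_zero)
    qed
    have i: "integrable circle (\<lambda>\<phi>. 2 * \<i> * cnj (g \<phi>))" using g by auto
    have sm: "s k \<in> borel_measurable circle" for k
      unfolding s_def by (rule borel_measurable_integrable, rule continuous_circle_integrable) (intro continuous_intros)
    have sb: "cmod (s k x) \<le> 1" for k x by (simp add: s_def)
    note S = sums_integral_mult_suminf[OF i sm sb c]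
    have "(\<Sum>k. c k * e k \<theta>) = (\<integral>\<phi>. (2 * \<i> * cnj (g \<phi>)) * (\<Sum>k. c k * s k \<phi>) \<partial>circle)"
      using S(1) unfolding eq by (rule sums_unique[symmetric])
    also have "cmod \<dots> \<le> (\<integral>\<phi>. cmod ((2 * \<i> * cnj (g \<phi>)) * (\<Sum>k. c k * s k \<phi>)) \<partial>circle)"
      by (rule integral_norm_bound)
    also have "\<dots> \<le> (\<integral>\<phi>. 2 * pi * cmod (g \<phi>) \<partial>circle)"
    proof (rule integral_mono)
      fix \<phi>
      have "cmod (\<Sum>k. c k * s k \<phi>) \<le> pi"
        unfolding c_def s_def by (rule abel_sine_sum_bound[OF \<rho>])
      then show "cmod ((2 * \<i> * cnj (g \<phi>)) * (\<Sum>k. c k * s k \<phi>)) \<le> 2 * pi * cmod (g \<phi>)"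
        using mult_left_mono[of "cmod (\<Sum>k. c k * s k \<phi>)" pi "2 * cmod (g \<phi>)"]
        by (simp add: norm_mult mult_ac)
    qed (use g S(2) in auto)
    also have "\<dots> = 2 * pi * G" by (simp add: G_def)
    finally show ?thesis .
  qed
  note T = sums_integral_mult_suminf[OF g e_meas e_bound c]
  have cc: "(\<integral>\<theta>. g \<theta> * e k \<theta> \<partial>circle) = of_real ((cmod (P k))\<^sup>2 - (cmod (Q k))\<^sup>2)" for k
  proof -
    have i: "integrable circle (\<lambda>\<theta>. g \<theta> * cis (- of_int m * \<theta>))" for m
    proof (rule Bochner_Integration.integrable_bound[of _ g])
      show "(\<lambda>\<theta>. g \<theta> * cis (- of_int m * \<theta>)) \<in> borel_measurable circle"
        using g by (intro borel_measurable_times measurable_circle_cis) auto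
    qed (use g in \<open>auto simp: norm_mult\<close>)
    have "g \<theta> * e k \<theta> = (g \<theta> * cis (- of_int (int k) * \<theta>)) * cnj (P k)
        - (g \<theta> * cis (- of_int (- int k) * \<theta>)) * cnj (Q k)" for \<theta>
      by (simp add: e_def algebra_simps)
    then have "(\<integral>\<theta>. g \<theta> * e k \<theta> \<partial>circle) = P k * cnj (P k) - Q k * cnj (Q k)"
      unfolding P_def Q_def circle_coeff_def
      by (simp only: Bochner_Integration.integral_diff integrable_mult_left i integral_mult_left_zero)
    then show ?thesis by (simp add: complex_norm_square del: of_real_power)
  qed
  have "(\<lambda>k. c k * of_real ((cmod (P k))\<^sup>2 - (cmod (Q k))\<^sup>2)) sums (\<integral>\<theta>. g \<theta> * (\<Sum>k. c k * e k \<theta>) \<partial>circle)"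
    using T(1) unfolding cc .
  then have *: "(\<lambda>k. complex_of_real (\<rho> ^ k / k * ((cmod (P k))\<^sup>2 - (cmod (Q k))\<^sup>2)))
      sums (\<integral>\<theta>. g \<theta> * (\<Sum>k. c k * e k \<theta>) \<partial>circle)"
    by (simp only: c_def of_real_mult)
  have s: "summable (\<lambda>k. \<rho> ^ k / k * ((cmod (P k))\<^sup>2 - (cmod (Q k))\<^sup>2))"
    using * summable_of_real_iff sums_summable by blast
  have "complex_of_real (\<Sum>k. \<rho> ^ k / k * ((cmod (P k))\<^sup>2 - (cmod (Q k))\<^sup>2)) = (\<integral>\<theta>. g \<theta> * (\<Sum>k. c k * e k \<theta>) \<partial>circle)"
    using sums_unique[OF *] suminf_of_real[OF s, where 'a = complex] by simp
  also have "cmod \<dots> \<le> (\<integral>\<theta>. cmod (g \<theta> * (\<Sum>k. c k * e k \<theta>)) \<partial>circle)"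
    by (rule integral_norm_bound)
  \<comment> \<open>One factor G sits in the kernel bound; the second comes from integrating that
    bound against |g|.\<close>
  also have "\<dots> \<le> (\<integral>\<theta>. cmod (g \<theta>) * (2 * pi * G) \<partial>circle)"
    using g integrable_norm[OF T(2)] by (intro integral_mono) (auto simp: norm_mult intro!: mult_left_mono kernel)
  also have "\<dots> = 2 * pi * G\<^sup>2" by (simp add: G_def power2_eq_square)
  finally show ?thesis by (simp only: norm_of_real P_def Q_def)
qed

text \<open>The Abel sum of the positive part exceeds that of the negative part by at most the
  sawtooth bound, and letting \<rho> tend to 1 in a finite sum removes the Abel factor.
  \<open>B\<close> has to bound all partial sums because the Abel sums involve every
  frequency.\<close>

lemma positive_coeffs_bound:
  assumes g: "integrable circle g"
    and B: "\<And>N. (\<Sum>k=1..N. (cmod (circle_coeff g (- int k)))\<^sup>2 / k) \<le> B"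
  shows "(\<Sum>k=1..N. (cmod (circle_coeff g (int k)))\<^sup>2 / k) \<le> B + 2 * pi * (\<integral>\<theta>. cmod (g \<theta>) \<partial>circle)\<^sup>2"
proof -
  define G where "G = (\<integral>\<theta>. cmod (g \<theta>) \<partial>circle)"
  define P where "P = (\<lambda>k::nat. (cmod (circle_coeff g (int k)))\<^sup>2)"
  define Q where "Q = (\<lambda>k::nat. (cmod (circle_coeff g (- int k)))\<^sup>2)"
  have G: "G \<ge> 0" by (simp add: G_def integral_nonneg_AE)
  have nn: "P k \<ge> 0" "Q k \<ge> 0" for k by (simp_all add: P_def Q_def)
  have PQ: "P k \<le> G\<^sup>2" "Q k \<le> G\<^sup>2" for k
    using cmod_circle_coeff_le[OF g] by (simp_all add: P_def Q_def G_def power_mono)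
  have *: "(\<Sum>k=1..N. \<rho> ^ k * (P k / k)) \<le> B + 2 * pi * G\<^sup>2" if \<rho>: "0 \<le> \<rho>" "\<rho> < 1" for \<rho>
  proof -
    have sm: "summable (\<lambda>k. \<rho> ^ k / k * F k)" if "\<And>k. F k \<ge> 0" "\<And>k. F k \<le> G\<^sup>2" for F :: "nat \<Rightarrow> real"
    proof (rule summable_comparison_test')
      show "summable (\<lambda>k. \<rho> ^ k / k * G\<^sup>2)" by (rule summable_mult2[OF summable_power_div[OF \<rho>]])
      show "norm (\<rho> ^ k / k * F k) \<le> \<rho> ^ k / k * G\<^sup>2" for k
        using that \<rho> by (simp add: abs_mult mult_left_mono divide_right_mono)
    qed
    have sP: "summable (\<lambda>k. \<rho> ^ k / k * P k)" and sQ: "summable (\<lambda>k. \<rho> ^ k / k * Q k)"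
      using sm nn PQ by auto
    have "(\<Sum>k=1..N. \<rho> ^ k * (P k / k)) = (\<Sum>k=1..N. \<rho> ^ k / k * P k)" by simp
    also have "\<dots> \<le> (\<Sum>k. \<rho> ^ k / k * P k)"
      by (rule sum_le_suminf[OF sP]) (auto simp: \<rho> nn)
    also have "\<dots> = (\<Sum>k. \<rho> ^ k / k * Q k) + (\<Sum>k. \<rho> ^ k / k * (P k - Q k))"
      using suminf_diff[OF sP sQ] by (simp add: right_diff_distrib)
    also have "(\<Sum>k. \<rho> ^ k / k * Q k) \<le> B"
    proof (rule suminf_le_const[OF sQ])
      fix n
      have "(\<Sum>k<n. \<rho> ^ k / k * Q k) \<le> (\<Sum>k<n. Q k / k)"
        using \<rho> nn by (intro sum_mono) (auto simp: power_le_one mult_left_le_one_le divide_right_mono)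
      \<comment> \<open>The index 0 drops out because \<open>Q 0 / 0 = 0\<close>.\<close>
      also have "\<dots> = (\<Sum>k\<in>{1..<n}. Q k / k)"
        by (rule sum.mono_neutral_right) auto
      also have "\<dots> \<le> (\<Sum>k=1..n. Q k / k)"
        using nn by (intro sum_mono2) auto
      also have "\<dots> \<le> B" using B by (simp add: Q_def)
      finally show "(\<Sum>k<n. \<rho> ^ k / k * Q k) \<le> B" .
    qed
    also have "(\<Sum>k. \<rho> ^ k / k * (P k - Q k)) \<le> 2 * pi * G\<^sup>2"
      using abel_coeff_difference[OF g \<rho>] by (simp add: P_def Q_def G_def)
    finally show ?thesis by simp
  qed
  have "((\<lambda>\<rho>. \<Sum>k=1..N. \<rho> ^ k * (P k / k)) \<longlongrightarrow> (\<Sum>k=1..N. 1 ^ k * (P k / k))) (at_left 1)"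
    by (intro tendsto_intros)
  then have "(\<Sum>k=1..N. 1 ^ k * (P k / k)) \<le> B + 2 * pi * G\<^sup>2"
  proof (rule tendsto_upperbound)
    show "\<forall>\<^sub>F \<rho> in at_left 1. (\<Sum>k=1..N. \<rho> ^ k * (P k / k)) \<le> B + 2 * pi * G\<^sup>2"
      by (rule eventually_mono[OF eventually_at_left_real[of 0 1]]) (simp, rule *, auto)
  qed simp
  then show ?thesis by (simp add: P_def G_def)
qed

section \<open>The norms and their comparison\<close>

lemma ennreal_sqrt_ennreal:
  assumes "0 \<le> x"
  shows "ennreal_sqrt (ennreal x) = ennreal (sqrt x)"
  using assms by (simp add: ennreal_sqrt_def)

lemma ennreal_sqrt_mono: "x \<le> y \<Longrightarrow> ennreal_sqrt x \<le> ennreal_sqrt y"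
  by (cases x; cases y) (auto simp: ennreal_sqrt_def top_unique)

lemma ennreal_sqrt_less_top_iff: "ennreal_sqrt x < top \<longleftrightarrow> x < top"
  by (cases x) (auto simp: ennreal_sqrt_def)

lemma sum_le_H_minus_half_norm:
  assumes "H_minus_half_norm v = ennreal H" "0 \<le> H" "finite K"
  shows "(\<Sum>k\<in>K. (1 + (real_of_int \<bar>k\<bar>)\<^sup>2) powr (-1/2) * (cmod (fourier_coeff v k))\<^sup>2) \<le> H\<^sup>2"
    (is "sum ?f K \<le> _")
proof -
  have "ennreal (sum ?f K) = (\<Sum>k\<in>K. ennreal (?f k))"
    by (rule sum_ennreal[symmetric]) auto
  also have "\<dots> \<le> (\<Sum>\<^sub>\<infinity>k. ennreal (?f k))"
    using assms(3) by (subst nonneg_infsum_complete) (auto intro: SUP_upper)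
  finally have "ennreal_sqrt (ennreal (sum ?f K)) \<le> ennreal H"
    unfolding assms(1)[symmetric] H_minus_half_norm_def by (rule ennreal_sqrt_mono)
  moreover have "0 \<le> sum ?f K" by (auto intro: sum_nonneg)
  ultimately have "sqrt (sum ?f K) \<le> H" using assms(2) by (simp add: ennreal_sqrt_ennreal)
  then show ?thesis by (rule sqrt_le_D)
qed

text \<open>Relates the weight of the norm to 1 / (n + 1) from the area integral and to 1 / n from
  the sawtooth kernel. Everything reduces to comparing sqrt (1 + n^2) with n + 1 or n.\<close>

lemma weight_bounds:
  fixes n :: nat
  shows "1 / (real n + 1) \<le> (1 + (real n)\<^sup>2) powr (-1/2)"
    and "(1 + (real n)\<^sup>2) powr (-1/2) \<le> 2 / (real n + 1)"
    and "n \<ge> 1 \<Longrightarrow> 1 / real n \<le> 2 * (1 + (real n)\<^sup>2) powr (-1/2)"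
proof -
  have w: "(1 + (real n)\<^sup>2) powr (-1/2) = 1 / sqrt (1 + (real n)\<^sup>2)"
    by (simp add: powr_minus powr_half_sqrt divide_simps)
  have pos: "sqrt (1 + (real n)\<^sup>2) > 0" by (simp add: add_pos_nonneg)
  have "sqrt (1 + (real n)\<^sup>2) \<le> real n + 1"
    by (rule real_le_lsqrt) (auto simp: power2_eq_square algebra_simps)
  then show "1 / (real n + 1) \<le> (1 + (real n)\<^sup>2) powr (-1/2)"
    unfolding w using pos by (intro divide_left_mono) auto
  have "(real n + 1) / 2 \<le> sqrt (1 + (real n)\<^sup>2)"
  proof (rule real_le_rsqrt)
    \<comment> \<open>The right-hand side is 4 (1 + n^2) - (n + 1)^2, rearranged so that its sign is
      visible.\<close>
    have "0 \<le> (real n - 1)\<^sup>2 + 2 * (real n)\<^sup>2 + 2" by simp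
    then show "((real n + 1) / 2)\<^sup>2 \<le> 1 + (real n)\<^sup>2"
      by (simp add: power2_eq_square field_simps)
  qed
  then show "(1 + (real n)\<^sup>2) powr (-1/2) \<le> 2 / (real n + 1)"
    unfolding w using pos by (simp add: field_simps)
  assume n: "n \<ge> 1"
  have "1 \<le> real n * real n" using n mult_mono[of 1 "real n" 1 "real n"] by simp
  then have "sqrt (1 + (real n)\<^sup>2) \<le> 2 * real n"
    by (intro real_le_lsqrt) (auto simp: power2_eq_square)
  then show "1 / real n \<le> 2 * (1 + (real n)\<^sup>2) powr (-1/2)"
    unfolding w using pos n by (simp add: field_simps)
qed

text \<open>Distributions are compared only on test functions, so the Fourier coefficients of a
  decomposition add up only once the exponentials are known to be such. Each derivative multiplies
  by - i k.\<close>

lemma cis_test_function: "(\<lambda>\<theta>. exp (- \<i> * of_int k * of_real \<theta>)) \<in> circle_test_functions"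
proof -
  define c where "c = - \<i> * of_int k"
  have d: "((\<lambda>\<theta>::real. b * exp (c * of_real \<theta>)) has_vector_derivative (b * c) * exp (c * of_real x)) (at x)" for b x
  proof -
    have "((\<lambda>z. b * exp (c * z)) has_field_derivative (b * c) * exp (c * of_real x)) (at (of_real x))"
      by (auto intro!: derivative_eq_intros)
    from has_vector_derivative_real_field[OF this, of UNIV] show ?thesis by (simp add: o_def)
  qed
  have n: "nth_derivative n (\<lambda>\<theta>. exp (c * of_real \<theta>)) = (\<lambda>\<theta>. c ^ n * exp (c * of_real \<theta>))" for n
  proof (induction n)
    case (Suc n)
    have "nth_derivative (Suc n) (\<lambda>\<theta>. exp (c * of_real \<theta>)) = (\<lambda>x. vector_derivative (nth_derivative n (\<lambda>\<theta>. exp (c * of_real \<theta>))) (at x))"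
      by (simp add: nth_derivative_def)
    then show ?case unfolding Suc.IH using vector_derivative_at[OF d, of "c ^ n"] by (simp add: mult.commute)
  qed (simp add: nth_derivative_def)
  have "exp (c * of_real (x + 2 * pi)) = exp (c * of_real x)" for x :: real
  proof -
    have eq: "c * of_real (x + 2 * pi) = c * of_real x + complex_of_real (2 * of_int (- k) * pi) * \<i>"
      by (simp add: c_def algebra_simps)
    have "exp (complex_of_real (2 * of_int (- k) * pi) * \<i>) = 1" by (rule exp_integer_2pi) simp
    then show ?thesis by (simp only: eq exp_add mult_1_right)
  qed
  moreover have "nth_derivative n (\<lambda>\<theta>. exp (c * of_real \<theta>)) differentiable (at x)" for n x
    unfolding n using d by (rule differentiableI_vector)
  ultimately show ?thesis unfolding c_def[symmetric]
    by (simp add: circle_test_functions_def periodic_2pi_def)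
qed

lemma test_function_continuous:
  assumes "\<phi> \<in> circle_test_functions"
  shows "continuous_on UNIV \<phi>"
proof -
  have "nth_derivative 0 \<phi> differentiable (at x)" for x
    using assms by (simp add: circle_test_functions_def del: funpow.simps)
  then have "isCont \<phi> x" for x
    by (simp add: nth_derivative_def differentiable_imp_continuous_within)
  then show ?thesis by (simp add: continuous_at_imp_continuous_on)
qed

text \<open>A real \<open>SUP\<close> is an upper bound only for a bounded family. Periodicity
  reduces boundedness to a compact interval.\<close>

lemma test_function_bdd_above:
  assumes "\<phi> \<in> circle_test_functions"
  shows "bdd_above (range (\<lambda>x. cmod (\<phi> x)))"
proof -
  have per: "\<phi> (x + 2 * pi) = \<phi> x" for x
    using assms by (simp add: circle_test_functions_def periodic_2pi_def)
  interpret periodic_fun_simple \<phi> "2 * pi"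
    by standard (rule per)
  have "compact ((\<lambda>x. cmod (\<phi> x)) ` {0..2*pi})"
    by (intro compact_continuous_image continuous_intros continuous_on_subset[OF test_function_continuous[OF assms]]) auto
  then obtain B where B: "cmod (\<phi> x) \<le> B" if "x \<in> {0..2*pi}" for x
    using bounded_imp_bdd_above[OF compact_imp_bounded] by (fastforce simp: bdd_above_def)
  have "cmod (\<phi> x) \<le> B" for x
  proof -
    define m where "m = \<lfloor>x / (2 * pi)\<rfloor>"
    have "of_int m \<le> x / (2 * pi)" "x / (2 * pi) \<le> of_int m + 1" unfolding m_def by linarith+
    then have "x - of_int m * (2 * pi) \<in> {0..2*pi}" by (simp add: field_simps)
    moreover have "\<phi> (x - of_int m * (2 * pi)) = \<phi> x" by (rule minus_of_int)
    ultimately show ?thesis using B by metis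
  qed
  then show ?thesis by (auto simp: bdd_above_def)
qed

lemma distribution_of_eq: "distribution_of F \<phi> = (\<integral>\<theta>. F \<theta> * \<phi> \<theta> \<partial>circle)"
  unfolding distribution_of_def
  by (simp add: set_lebesgue_integral_def integral_restrict_space)

text \<open>Such a distribution has order 0: the seminorm with \<open>N = 0\<close> suffices, with
  the L^1 norm of F as constant.\<close>

lemma circle_distribution_of_continuous:
  assumes F: "continuous_on UNIV F"
  shows "circle_distribution (distribution_of F)"
proof -
  have i: "integrable circle (\<lambda>\<theta>. F \<theta> * \<phi> \<theta>)" if "\<phi> \<in> circle_test_functions" for \<phi>
    using test_function_continuous[OF that] F by (intro continuous_circle_integrable continuous_intros)
  have iF: "integrable circle F" by (rule continuous_circle_integrable[OF F])
  have "cmod (distribution_of F \<phi>) \<le> (\<integral>\<theta>. cmod (F \<theta>) \<partial>circle) * (\<Sum>j\<le>0. SUP x. cmod (nth_derivative j \<phi> x))"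
    if \<phi>: "\<phi> \<in> circle_test_functions" for \<phi>
  proof -
    have le: "cmod (\<phi> x) \<le> (SUP x. cmod (\<phi> x))" for x
      by (rule cSUP_upper[OF _ test_function_bdd_above[OF \<phi>]]) simp
    have "cmod (distribution_of F \<phi>) \<le> (\<integral>\<theta>. cmod (F \<theta> * \<phi> \<theta>) \<partial>circle)"
      unfolding distribution_of_eq by (rule integral_norm_bound)
    also have "\<dots> \<le> (\<integral>\<theta>. cmod (F \<theta>) * (SUP x. cmod (\<phi> x)) \<partial>circle)"
      using integrable_norm[OF i[OF \<phi>]] iF le by (intro integral_mono) (auto simp: norm_mult mult_left_mono)
    finally show ?thesis by (simp add: nth_derivative_def)
  qed
  then have "\<exists>B N. \<forall>\<phi>\<in>circle_test_functions.
      cmod (distribution_of F \<phi>) \<le> B * (\<Sum>j\<le>N. SUP x. cmod (nth_derivative j \<phi> x))"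
    by blast
  then show ?thesis unfolding circle_distribution_def
    using i by (auto simp: distribution_of_eq distrib_left mult.left_commute)
qed

section \<open>Power series in the disc and two-sided bounds for their norms on circles\<close>

lemma disc_power_series:
  assumes f: "f holomorphic_on ball 0 1"
  shows "\<exists>a :: nat \<Rightarrow> complex. \<forall>z\<in>ball 0 1.
    (\<lambda>n. a n * z ^ n) sums f z \<and> summable (\<lambda>n. cmod (a n * z ^ n))"
proof -
  define a where "a = (\<lambda>n. (deriv ^^ n) f 0 / fact n)"
  have s: "(\<lambda>n. a n * z ^ n) sums f z" if "z \<in> ball 0 1" for z
    using holomorphic_power_series[OF f that] by (simp add: a_def)
  have "summable (\<lambda>n. cmod (a n * z ^ n))" if z: "z \<in> ball 0 1" for z
  proof -
    \<comment> \<open>A point whose modulus lies midway between |z| and 1: convergence at w forces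
      absolute convergence at z.\<close>
    define w where "w = complex_of_real ((1 + cmod z) / 2)"
    have "cmod w = (1 + cmod z) / 2" unfolding w_def by (simp only: norm_of_real) simp
    then have "w \<in> ball 0 1" "norm z < norm w" using z by simp_all
    then show ?thesis using powser_insidea[of a w z] sums_summable[OF s] by simp
  qed
  with s show ?thesis by (intro exI[of _ a]) auto
qed

text \<open>The bound is shown for every admissible pair g, h. With G and H their norms, the sum is
  at most 4 G^2 + 6 H^2 <= 6 (G + H)^2, whence the 6. Only finitely many terms are kept, so that a
  limit in the radius can be taken inside.\<close>

lemma L1_plus_H_minus_half_norm_lower:
  fixes b :: "nat \<Rightarrow> complex"
  assumes b: "summable (\<lambda>n. cmod (b n))"
  shows "ennreal (sqrt ((\<Sum>n\<le>N. (cmod (b n))\<^sup>2 / (n + 1)) / 6)) \<le>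
    L1_plus_H_minus_half_norm (distribution_of (\<lambda>\<theta>. \<Sum>n. b n * cis (of_nat n * \<theta>)))"
  unfolding L1_plus_H_minus_half_norm_def
proof (rule INF_greatest, clarify)
  let ?F = "\<lambda>\<theta>. \<Sum>n. b n * cis (of_nat n * \<theta>)"
  fix g h
  assume gL: "g \<in> L1_circle" and h: "h \<in> H_minus_half"
    and eq: "\<forall>\<phi>\<in>circle_test_functions. distribution_of ?F \<phi> = distribution_of g \<phi> + h \<phi>"
  have g: "integrable circle g"
    using gL by (simp add: L1_circle_def absolutely_integrable_on_def integrable_restrict_space set_integrable_def)
  define G where "G = (\<integral>\<theta>. cmod (g \<theta>) \<partial>circle)"
  have G: "L1_circle_norm g = ennreal G" "0 \<le> G"
  proof -
    have "L1_circle_norm g = (\<integral>\<^sup>+\<theta>. ennreal (cmod (g \<theta>)) \<partial>circle)"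
      unfolding L1_circle_norm_def by (subst nn_integral_restrict_space) auto
    also have "\<dots> = ennreal G"
      unfolding G_def using g by (intro nn_integral_eq_integral) auto
    finally show "L1_circle_norm g = ennreal G" .
  qed (simp add: G_def integral_nonneg_AE)
  obtain H where H: "H_minus_half_norm h = ennreal H" "0 \<le> H"
    using h by (cases "H_minus_half_norm h") (auto simp: H_minus_half_def)
  define p where "p = (\<lambda>k. circle_coeff g k / of_real (2 * pi))"
  define q where "q = fourier_coeff h"
  define w where "w = (\<lambda>n::nat. (1 + (real n)\<^sup>2) powr (-1/2))"
  have coeff: "(if k \<ge> 0 then b (nat k) else 0) = p k + q k" for k
  proof -
    have "fourier_coeff (distribution_of ?F) k = p k + q k"
      unfolding p_def q_def fourier_coeff_distribution_of[symmetric]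
      using eq cis_test_function[of k] by (simp add: fourier_coeff_def add_divide_distrib)
    then show ?thesis
      by (simp add: fourier_coeff_distribution_of circle_coeff_cis_series[OF b] split: if_splits)
  qed
  \<comment> \<open>The sign s = 1 serves the direct bound on h, s = -1 the transfer of its negative
    coefficients to g.\<close>
  have q: "(\<Sum>n\<in>A. w n * (cmod (q (s * int n)))\<^sup>2) \<le> H\<^sup>2" if "finite A" "\<bar>s\<bar> = 1" for A s
  proof -
    have inj: "inj_on (\<lambda>n. s * int n) A" using that by (auto intro!: inj_onI)
    have "s = 1 \<or> s = - 1" using that by linarith
    then show ?thesis
      using sum_le_H_minus_half_norm[OF H, of "(\<lambda>n. s * int n) ` A"] that inj
      by (elim disjE) (simp_all add: sum.reindex o_def w_def q_def)
  qed
  \<comment> \<open>At negative frequencies \<open>coeff\<close> reads 0 = p + q. The 2 is the price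
    of replacing 1 / k by \<open>w k\<close>, and (2 pi)^2 accounts for the missing normalisation of
    \<open>circle_coeff\<close>.\<close>
  have "(\<Sum>k=1..M. (cmod (circle_coeff g (- int k)))\<^sup>2 / k) \<le> (2 * pi)\<^sup>2 * (2 * H\<^sup>2)" for M
  proof -
    have "(\<Sum>k=1..M. (cmod (circle_coeff g (- int k)))\<^sup>2 / k) \<le>
        (\<Sum>k=1..M. (2 * pi)\<^sup>2 * (2 * (w k * (cmod (q (- 1 * int k)))\<^sup>2)))"
    proof (rule sum_mono)
      fix k assume "k \<in> {1..M}"
      then have k: "k \<ge> 1" by simp
      have "p (- int k) = - q (- int k)" using coeff[of "- int k"] k by (simp add: eq_neg_iff_add_eq_0)
      then have "cmod (p (- int k)) = cmod (q (- int k))" by simp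
      then have "cmod (circle_coeff g (- int k)) = 2 * pi * cmod (q (- int k))"
        by (simp add: p_def norm_divide norm_mult field_simps)
      then have "(cmod (circle_coeff g (- int k)))\<^sup>2 / k = (2 * pi)\<^sup>2 * (1 / k * (cmod (q (- int k)))\<^sup>2)"
        by (simp add: power_mult_distrib)
      also have "\<dots> \<le> (2 * pi)\<^sup>2 * (2 * w k * (cmod (q (- int k)))\<^sup>2)"
        using weight_bounds(3)[OF k] by (intro mult_left_mono mult_right_mono) (auto simp: w_def)
      finally show "(cmod (circle_coeff g (- int k)))\<^sup>2 / k \<le> (2 * pi)\<^sup>2 * (2 * (w k * (cmod (q (- 1 * int k)))\<^sup>2))"
        by simp
    qed
    also have "\<dots> = (2 * pi)\<^sup>2 * (2 * (\<Sum>k=1..M. w k * (cmod (q (- 1 * int k)))\<^sup>2))"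
      by (simp only: sum_distrib_left)
    also have "\<dots> \<le> (2 * pi)\<^sup>2 * (2 * H\<^sup>2)"
      using q[of "{1..M}" "- 1"] by (intro mult_left_mono) auto
    finally show ?thesis .
  qed
  from positive_coeffs_bound[OF g this]
  have "(\<Sum>k=1..N. (cmod (circle_coeff g (int k)))\<^sup>2 / k) \<le> (2 * pi)\<^sup>2 * (2 * H\<^sup>2) + 2 * pi * G\<^sup>2"
    by (simp add: G_def)
  \<comment> \<open>Enlarging 2 pi to its square creates a common factor that can be divided
    out.\<close>
  also have "\<dots> \<le> (2 * pi)\<^sup>2 * (2 * H\<^sup>2) + (2 * pi)\<^sup>2 * G\<^sup>2"
    using pi_gt3 by (intro add_left_mono mult_right_mono) (auto simp: power2_eq_square)
  also have "(\<Sum>k=1..N. (cmod (circle_coeff g (int k)))\<^sup>2 / k) = (2 * pi)\<^sup>2 * (\<Sum>k=1..N. (cmod (p (int k)))\<^sup>2 / k)"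
    by (simp add: p_def norm_divide norm_mult power_divide sum_distrib_left)
  finally have "(2 * pi)\<^sup>2 * (\<Sum>k=1..N. (cmod (p (int k)))\<^sup>2 / k) \<le> (2 * pi)\<^sup>2 * (2 * H\<^sup>2 + G\<^sup>2)"
    by (simp only: distrib_left)
  then have p1: "(\<Sum>k=1..N. (cmod (p (int k)))\<^sup>2 / k) \<le> 2 * H\<^sup>2 + G\<^sup>2"
    by (rule mult_left_le_imp_le) simp
  \<comment> \<open>Frequency 0 is invisible to the sawtooth form; here the L^1 norm alone controls
    it.\<close>
  have "cmod (circle_coeff g 0) \<le> G * (2 * pi)"
    using cmod_circle_coeff_le[OF g, of 0] mult_left_mono[of 1 "2 * pi" G] G(2) pi_gt3 by (simp add: G_def)
  then have "cmod (p 0) \<le> G"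
    by (simp add: p_def norm_divide norm_mult divide_le_eq)
  then have p0: "(cmod (p 0))\<^sup>2 \<le> G\<^sup>2" by (simp add: power_mono)
  have "{..N} = insert 0 {1..N}" by auto
  then have "(\<Sum>n\<le>N. (cmod (p (int n)))\<^sup>2 / (n + 1)) = (cmod (p 0))\<^sup>2 + (\<Sum>n=1..N. (cmod (p (int n)))\<^sup>2 / (n + 1))"
    by simp
  also have "(\<Sum>n=1..N. (cmod (p (int n)))\<^sup>2 / (n + 1)) \<le> (\<Sum>n=1..N. (cmod (p (int n)))\<^sup>2 / n)"
    by (intro sum_mono divide_left_mono) auto
  finally have ps: "(\<Sum>n\<le>N. (cmod (p (int n)))\<^sup>2 / (n + 1)) \<le> 2 * G\<^sup>2 + 2 * H\<^sup>2"
    using p0 p1 by linarith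
  have "(\<Sum>n\<le>N. (cmod (q (int n)))\<^sup>2 / (n + 1)) \<le> (\<Sum>n\<le>N. w n * (cmod (q (1 * int n)))\<^sup>2)"
  proof (rule sum_mono)
    fix n
    show "(cmod (q (int n)))\<^sup>2 / (n + 1) \<le> w n * (cmod (q (1 * int n)))\<^sup>2"
      using mult_right_mono[OF weight_bounds(1)[of n], of "(cmod (q (int n)))\<^sup>2"] by (simp add: w_def add.commute)
  qed
  also have "\<dots> \<le> H\<^sup>2" by (rule q) auto
  finally have qs: "(\<Sum>n\<le>N. (cmod (q (int n)))\<^sup>2 / (n + 1)) \<le> H\<^sup>2" .
  \<comment> \<open>By (x + y)^2 <= 2 x^2 + 2 y^2, \<open>ps\<close> and \<open>qs\<close> combine
    to 2 (2 G^2 + 2 H^2) + 2 H^2.\<close>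
  have "(\<Sum>n\<le>N. (cmod (b n))\<^sup>2 / (n + 1)) \<le>
      (\<Sum>n\<le>N. 2 * ((cmod (p (int n)))\<^sup>2 / (n + 1)) + 2 * ((cmod (q (int n)))\<^sup>2 / (n + 1)))"
  proof (rule sum_mono)
    fix n
    have "cmod (b n) \<le> cmod (p (int n)) + cmod (q (int n))"
      using coeff[of "int n"] norm_triangle_ineq[of "p (int n)" "q (int n)"] by simp
    then have "(cmod (b n))\<^sup>2 \<le> (cmod (p (int n)) + cmod (q (int n)))\<^sup>2" by (simp add: power_mono)
    also have "\<dots> \<le> 2 * (cmod (p (int n)))\<^sup>2 + 2 * (cmod (q (int n)))\<^sup>2"
      using sum_squares_bound[of "cmod (p (int n))" "cmod (q (int n))"] by (simp add: power2_sum)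
    finally show "(cmod (b n))\<^sup>2 / (n + 1) \<le> 2 * ((cmod (p (int n)))\<^sup>2 / (n + 1)) + 2 * ((cmod (q (int n)))\<^sup>2 / (n + 1))"
      by (simp add: divide_right_mono flip: add_divide_distrib)
  qed
  also have "\<dots> = 2 * (\<Sum>n\<le>N. (cmod (p (int n)))\<^sup>2 / (n + 1)) + 2 * (\<Sum>n\<le>N. (cmod (q (int n)))\<^sup>2 / (n + 1))"
    by (simp only: sum.distrib sum_distrib_left)
  also have "\<dots> \<le> 4 * G\<^sup>2 + 6 * H\<^sup>2" using ps qs by linarith
  also have "\<dots> \<le> 6 * (G + H)\<^sup>2" using G(2) H(2) by (simp add: power2_sum)
  finally have "sqrt ((\<Sum>n\<le>N. (cmod (b n))\<^sup>2 / (n + 1)) / 6) \<le> G + H"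
    using G(2) H(2) by (intro real_le_lsqrt) auto
  then show "ennreal (sqrt ((\<Sum>n\<le>N. (cmod (b n))\<^sup>2 / (n + 1)) / 6)) \<le> L1_circle_norm g + H_minus_half_norm h"
    using G H by (simp flip: ennreal_plus)
qed

text \<open>Negative frequencies contribute nothing, so the sum over the integers becomes one over
  the naturals; the factor 2 compares (1 + n^2)^(-1/2) with 1 / (n + 1).\<close>

lemma L1_plus_H_minus_half_norm_upper:
  fixes b :: "nat \<Rightarrow> complex"
  assumes b: "summable (\<lambda>n. cmod (b n))"
  shows "L1_plus_H_minus_half_norm (distribution_of (\<lambda>\<theta>. \<Sum>n. b n * cis (of_nat n * \<theta>)))
    \<le> ennreal_sqrt (2 * (\<Sum>n. ennreal ((cmod (b n))\<^sup>2 / (n + 1))))"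
proof (cases "(\<Sum>n. ennreal ((cmod (b n))\<^sup>2 / (n + 1))) = \<infinity>")
  case True
  then show ?thesis by (simp add: ennreal_sqrt_def ennreal_mult_top)
next
  case False
  let ?F = "\<lambda>\<theta>. \<Sum>n. b n * cis (of_nat n * \<theta>)"
  let ?S = "2 * (\<Sum>n. ennreal ((cmod (b n))\<^sup>2 / (n + 1)))"
  let ?v = "distribution_of ?F"
  let ?w = "\<lambda>k. ennreal ((1 + (real_of_int \<bar>k\<bar>)\<^sup>2) powr (-1/2) * (cmod (fourier_coeff ?v k))\<^sup>2)"
  have "(\<Sum>\<^sub>\<infinity>k. ?w k) \<le> ?S"
  proof (rule infsum_le_finite_sums)
    fix K :: "int set" assume K: "finite K"
    have "(\<Sum>k\<in>K. ?w k) = (\<Sum>k\<in>K \<inter> {0..}. ?w k)"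
      using K by (intro sum.mono_neutral_right)
        (auto simp: fourier_coeff_distribution_of circle_coeff_cis_series[OF b])
    also have "\<dots> = (\<Sum>n\<in>nat ` (K \<inter> {0..}). ?w (int n))"
      by (subst sum.reindex) (auto simp: inj_on_def intro!: sum.cong)
    also have "\<dots> \<le> (\<Sum>n\<in>nat ` (K \<inter> {0..}). 2 * ennreal ((cmod (b n))\<^sup>2 / (n + 1)))"
    proof (rule sum_mono)
      fix n :: nat
      have "(1 + (real n)\<^sup>2) powr (-1/2) * (cmod (b n))\<^sup>2 \<le> 2 / (real n + 1) * (cmod (b n))\<^sup>2"
        by (intro mult_right_mono weight_bounds) auto
      then have "ennreal ((1 + (real n)\<^sup>2) powr (-1/2) * (cmod (b n))\<^sup>2) \<le> ennreal (2 * ((cmod (b n))\<^sup>2 / (n + 1)))"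
        by (intro ennreal_leI) (simp add: add.commute)
      also have "\<dots> = 2 * ennreal ((cmod (b n))\<^sup>2 / (n + 1))"
        by (subst ennreal_mult) auto
      finally show "?w (int n) \<le> 2 * ennreal ((cmod (b n))\<^sup>2 / (n + 1))"
        by (simp add: fourier_coeff_distribution_of circle_coeff_cis_series[OF b])
    qed
    also have "\<dots> \<le> (\<Sum>n. 2 * ennreal ((cmod (b n))\<^sup>2 / (n + 1)))"
      using K by (intro sum_le_suminf) auto
    finally show "(\<Sum>k\<in>K. ?w k) \<le> ?S" by simp
  qed (auto intro: nonneg_summable_on_complete)
  then have Hn: "H_minus_half_norm ?v \<le> ennreal_sqrt ?S"
    unfolding H_minus_half_norm_def by (rule ennreal_sqrt_mono)
  have "2 * S < top" if "S \<noteq> \<infinity>" for S :: ennreal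
    using that by (auto simp: ennreal_mult_less_top less_top)
  from this[OF False] have "ennreal_sqrt ?S < \<infinity>"
    by (simp only: ennreal_sqrt_less_top_iff infinity_ennreal_def)
  \<comment> \<open>Membership in \<open>H_minus_half\<close> includes finiteness of the norm, hence
    the case distinction.\<close>
  with Hn have "?v \<in> H_minus_half"
    using circle_distribution_of_continuous[OF continuous_cis_series[OF b]] by (auto simp: H_minus_half_def)
  then have "L1_plus_H_minus_half_norm ?v \<le> L1_circle_norm (\<lambda>_. 0) + H_minus_half_norm ?v"
    unfolding L1_plus_H_minus_half_norm_def
    by (intro INF_lower2[of "(\<lambda>_. 0, ?v)"]) (auto simp: L1_circle_def periodic_2pi_def distribution_of_eq)
  then show ?thesis using Hn by (simp add: L1_circle_norm_def)
qed

section \<open>Passage to the boundary and the constant\<close>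

theorem theorem1:
  shows "\<exists>C::real. C > 0 \<and>
    (\<forall>f::complex \<Rightarrow> complex. f holomorphic_on ball 0 1 \<longrightarrow>
       (f \<in> bergman_space \<longleftrightarrow> boundary_norm f < \<infinity>) \<and>
       L2_disc_norm f \<le> ennreal C * boundary_norm f)"
proof (intro exI[of _ 5] conjI allI impI)
  fix f :: "complex \<Rightarrow> complex"
  assume f: "f holomorphic_on ball 0 1"
  obtain a where "\<forall>z\<in>ball 0 1. (\<lambda>n. a n * z ^ n) sums f z \<and> summable (\<lambda>n. cmod (a n * z ^ n))"
    using disc_power_series[OF f] ..
  then have s: "\<And>z. z \<in> ball 0 1 \<Longrightarrow> (\<lambda>n. a n * z ^ n) sums f z"
    and abs: "\<And>z. z \<in> ball 0 1 \<Longrightarrow> summable (\<lambda>n. cmod (a n * z ^ n))"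
    by auto
  \<comment> \<open>The squared Bergman norm divided by pi, possibly infinite; both estimates are
    expressed through it.\<close>
  define A where "A = (\<Sum>n. ennreal ((cmod (a n))\<^sup>2 / (n + 1)))"
  have L2: "L2_disc_norm f = ennreal_sqrt (ennreal pi * A)"
    unfolding L2_disc_norm_def A_def
    by (rule arg_cong[of _ _ ennreal_sqrt], rule nn_integral_disc_power_series[OF f]) (fact s abs)+
  define b where "b = (\<lambda>r n. a n * complex_of_real r ^ n)"
  define V where "V = (\<lambda>r::real. L1_plus_H_minus_half_norm (distribution_of (\<lambda>\<theta>. f (of_real r * cis \<theta>))))"
  have b: "summable (\<lambda>n. cmod (b r n))" if "r \<in> {0<..<1}" for r
    unfolding b_def using that by (intro abs) auto
  have V: "V r = L1_plus_H_minus_half_norm (distribution_of (\<lambda>\<theta>. \<Sum>n. b r n * cis (of_nat n * \<theta>)))"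
    if r: "r \<in> {0<..<1}" for r
  proof -
    have "f (of_real r * cis \<theta>) = (\<Sum>n. b r n * cis (of_nat n * \<theta>))" for \<theta>
      using sums_unique[OF s[of "of_real r * cis \<theta>"]] r
      by (simp add: b_def norm_mult power_mult_distrib Complex.DeMoivre mult_ac)
    then show ?thesis by (simp add: V_def)
  qed
  have nb: "cmod (b r n) = cmod (a n) * r ^ n" if "r \<in> {0<..<1}" for r n
    using that by (simp add: b_def norm_mult norm_power)
  have ev: "\<forall>\<^sub>F r in at_left 1. r \<in> {0<..<1::real}"
    by (rule eventually_at_left_real) simp
  have upper: "boundary_norm f \<le> ennreal_sqrt (2 * A)"
    unfolding boundary_norm_def V_def[symmetric]
  proof (rule Limsup_bounded)
    show "\<forall>\<^sub>F r in at_left 1. V r \<le> ennreal_sqrt (2 * A)"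
      using ev
    proof eventually_elim
      case (elim r)
      have "(\<Sum>n. ennreal ((cmod (b r n))\<^sup>2 / (n + 1))) \<le> A"
        unfolding A_def
      proof (intro suminf_le ennreal_leI divide_right_mono power_mono)
        show "cmod (b r n) \<le> cmod (a n)" for n
          unfolding nb[OF elim] using elim by (intro mult_right_le_one_le) (auto simp: power_le_one)
      qed auto
      then have "ennreal_sqrt (2 * (\<Sum>n. ennreal ((cmod (b r n))\<^sup>2 / (n + 1)))) \<le> ennreal_sqrt (2 * A)"
        by (intro ennreal_sqrt_mono mult_left_mono) auto
      then show ?case
        unfolding V[OF elim] using L1_plus_H_minus_half_norm_upper[OF b[OF elim]] by (rule order_trans[rotated])
    qed
  qed
  have lower: "ennreal (sqrt ((\<Sum>n\<le>N. (cmod (a n))\<^sup>2 / (n + 1)) / 6)) \<le> boundary_norm f" for N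
  proof -
    let ?S = "\<lambda>r. sqrt ((\<Sum>n\<le>N. (cmod (a n) * r ^ n)\<^sup>2 / (n + 1)) / 6)"
    \<comment> \<open>For fixed N the lower bound is continuous in r up to r = 1, so its upper limit
      is its value there.\<close>
    have "(?S \<longlongrightarrow> ?S 1) (at_left 1)"
      by (intro tendsto_intros) auto
    then have "((\<lambda>r. ennreal (?S r)) \<longlongrightarrow> ennreal (?S 1)) (at_left 1)"
      by (rule tendsto_ennrealI)
    then have "ennreal (?S 1) = Limsup (at_left 1) (\<lambda>r. ennreal (?S r))"
      by (intro lim_imp_Limsup[symmetric]) auto
    also have "\<dots> \<le> Limsup (at_left 1) V"
    proof (rule Limsup_mono)
      show "\<forall>\<^sub>F r in at_left 1. ennreal (?S r) \<le> V r"
        using ev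
      proof eventually_elim
        case (elim r)
        show ?case unfolding V[OF elim]
          using L1_plus_H_minus_half_norm_lower[OF b[OF elim], of N] by (simp only: nb[OF elim])
      qed
    qed
    finally show ?thesis by (simp add: boundary_norm_def V_def)
  qed
  show main: "L2_disc_norm f \<le> ennreal 5 * boundary_norm f"
  proof (cases "boundary_norm f")
    case (real B)
    have *: "(\<Sum>n\<le>N. (cmod (a n))\<^sup>2 / (n + 1)) \<le> 6 * B\<^sup>2" for N
    proof -
      have "sqrt ((\<Sum>n\<le>N. (cmod (a n))\<^sup>2 / (n + 1)) / 6) \<le> B"
        using lower[of N] real by simp
      then show ?thesis using sqrt_le_D by fastforce
    qed
    \<comment> \<open>Only here does the number of terms tend to infinity; the bound on partial sums
      is uniform in N.\<close>
    have "A \<le> ennreal (6 * B\<^sup>2)"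
      unfolding A_def
    proof (intro suminf_le_const)
      fix n
      have "(\<Sum>k<n. (cmod (a k))\<^sup>2 / (k + 1)) \<le> (\<Sum>k\<le>n. (cmod (a k))\<^sup>2 / (k + 1))"
        by (intro sum_mono2) auto
      also note *
      finally show "(\<Sum>k<n. ennreal ((cmod (a k))\<^sup>2 / (k + 1))) \<le> ennreal (6 * B\<^sup>2)"
        by (subst sum_ennreal) (auto intro!: ennreal_leI)
    qed auto
    then have "ennreal pi * A \<le> ennreal (pi * (6 * B\<^sup>2))"
      by (simp add: ennreal_mult mult_left_mono)
    also have "\<dots> \<le> ennreal ((5 * B)\<^sup>2)"
    proof (rule ennreal_leI)
      \<comment> \<open>Origin of the constant 5: 6 pi < 24 < 25 = 5^2.\<close>
      have "pi * (6 * B\<^sup>2) \<le> 4 * (6 * B\<^sup>2)"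
        using pi_less_4 by (intro mult_right_mono) auto
      also have "\<dots> \<le> (5 * B)\<^sup>2" by (simp add: power_mult_distrib)
      finally show "pi * (6 * B\<^sup>2) \<le> (5 * B)\<^sup>2" .
    qed
    finally have "L2_disc_norm f \<le> ennreal_sqrt (ennreal ((5 * B)\<^sup>2))"
      unfolding L2 by (rule ennreal_sqrt_mono)
    also have "\<dots> = ennreal \<bar>5 * B\<bar>"
      by (simp only: ennreal_sqrt_ennreal[OF zero_le_power2] real_sqrt_abs)
    also have "\<dots> = ennreal 5 * ennreal B"
      using real by (subst ennreal_mult[symmetric]) auto
    finally show ?thesis using real by simp
  qed (simp add: ennreal_mult_top)
  show "f \<in> bergman_space \<longleftrightarrow> boundary_norm f < \<infinity>"
  proof
    assume "f \<in> bergman_space"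
    then have "ennreal pi * A < \<infinity>" by (simp add: bergman_space_def L2 ennreal_sqrt_less_top_iff)
    then have "A < \<infinity>" by (auto simp: ennreal_mult_less_top)
    then have "ennreal_sqrt (2 * A) < \<infinity>" by (simp add: ennreal_sqrt_less_top_iff ennreal_mult_less_top)
    with upper show "boundary_norm f < \<infinity>" by (rule le_less_trans)
  next
    assume "boundary_norm f < \<infinity>"
    then have "ennreal 5 * boundary_norm f < \<infinity>" by (simp add: ennreal_mult_less_top)
    with main have "L2_disc_norm f < \<infinity>" by (rule le_less_trans)
    with f show "f \<in> bergman_space" by (simp add: bergman_space_def)
  qed
qed simp

end
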